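(* Let $F_1,F_2:\mathbb R\to(0,\infty)$ be measurable and $\psi\in\mathcal C$ with $I(F_1\circ\psi,\psi),I(F_2\circ\psi^*,\psi^* )\in(0,\infty)$. Let $h,h_1$ be functions such that $h_1$ has an inverse $h_1^{-1}$, and put $H=h\circ h_1^{-1}$. (i) Assume one of: (a) $h\in\Phi$, $h_1\in\Psi$ and $H$ increasing; (b) $h,h_1\in\Phi$ and $H$ decreasing; (c) $H$ concave and increasing, and either $h,h_1\in\Phi$ or $h,h_1\in\Psi$. Then $$\frac{as^{orlicz}_{h,F_1,F_2}(\psi)}{I(F_1\circ\psi,\psi)}\le H\Big(\frac{as^{orlicz}_{h_1,F_1,F_2}(\psi)}{I(F_1\circ\psi,\psi)}\Big).$$ (ii) Assume one of: (d) $h\in\Psi$, $h_1\in\Phi$ and $H$ increasing; (e) $H$ convex and decreasing, with one of $h,h_1$ in $\Phi$ and the other in $\Psi$; (f) $H$ convex and increasing, and either $h,h_1\in\Phi$ or $h,h_1\in\Psi$. Then $$\frac{as^{orlicz}_{h,F_1,F_2}(\psi)}{I(F_1\circ\psi,\psi)}\ge H\Big(\frac{as^{orlicz}_{h_1,F_1,F_2}(\psi)}{I(F_1\circ\psi,\psi)}\Big).$$ The same inequalities hold with $as^{orlicz}$ replaced by $G^{orlicz}$ throughout, provided in addition $F_2\circ\psi^*\in\mathcal L_{\psi^*}$ in cases (a), (b) and (d).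
   Context: $\mathcal C$ is the set of convex $\psi:\mathbb R^n\to\mathbb R\cup\{+\infty\}$ with domain of nonempty interior; $\psi^*(y)=\sup_x(\langle x,y\rangle-\psi(x))$; $\nabla^2\psi$ is the Alexandrov Hessian; $X_\psi=\{x:\psi(x)<\infty,\ \nabla^2\psi(x)\text{ exists and is invertible}\}$. $I(F\circ\psi,\psi)=\int_{X_\psi}F(\psi(x))dx$, $I(g,\psi^* )=\int_{X_{\psi^*}}g$; $\mathcal F^+_{\psi^*}$: integrable $g>0$ on $X_{\psi^*}$ with $0<I(g,\psi^* )<\infty$; $\mathcal L_{\psi^*}$: its log-concave members. For continuous $h:(0,\infty)\to(0,\infty)$, $V_{h,F_1,F_2}(\psi,g)=\int_{X_\psi}h\big(\frac{g(\nabla\psi(x))}{F_2(\langle x,\nabla\psi(x)\rangle-\psi(x))}\big)F_1(\psi(x))dx$. $\Phi$: $h$ constant or strictly convex; $\Psi$: $h$ constant or increasing strictly concave. For $h\in\Phi$, $as^{orlicz}_{h,F_1,F_2}(\psi)=\inf_{g\in\mathcal F^+_{\psi^*}}V_{h,F_1,F_2}(\psi,(\sqrt{2\pi})^ng/I(g,\psi^* ))$ and $G^{orlicz}_{h,F_1,F_2}(\psi)$ is the same infimum over $\mathcal L_{\psi^*}$; for $h\in\Psi$ replace $\inf$ by $\sup$. Standing assumption: all integrals are well defined. *)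

theory Defs
  imports "HOL-Analysis.Analysis"
begin

definition convC :: "('a::euclidean_space \<Rightarrow> ereal) \<Rightarrow> bool" where
  "convC \<psi> \<longleftrightarrow> (\<forall>x. \<psi> x \<noteq> -\<infinity>)
     \<and> (\<forall>x y. \<forall>t::real. 0 \<le> t \<and> t \<le> 1 \<longrightarrow>
          \<psi> ((1 - t) *\<^sub>R x + t *\<^sub>R y) \<le> ereal (1 - t) * \<psi> x + ereal t * \<psi> y)
     \<and> interior {x. \<psi> x < \<infinity>} \<noteq> {}"

definition legendre :: "('a::euclidean_space \<Rightarrow> ereal) \<Rightarrow> 'a \<Rightarrow> ereal" where
  "legendre \<psi> y = (SUP x. ereal (inner x y) - \<psi> x)"

definition alex_hessian :: "('a::euclidean_space \<Rightarrow> ereal) \<Rightarrow> 'a \<Rightarrow> ('a \<Rightarrow> 'a) \<Rightarrow> bool" where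
  "alex_hessian \<psi> x A \<longleftrightarrow> x \<in> interior {y. \<psi> y < \<infinity>} \<and> linear A
     \<and> (\<forall>u v. inner (A u) v = inner u (A v))
     \<and> (\<exists>g. ((\<lambda>y. (real_of_ereal (\<psi> y) - real_of_ereal (\<psi> x) - inner g (y - x)
                     - (1/2) * inner (A (y - x)) (y - x)) / (norm (y - x))\<^sup>2) \<longlongrightarrow> 0) (at x))"

definition Xset :: "('a::euclidean_space \<Rightarrow> ereal) \<Rightarrow> 'a set" where
  "Xset \<psi> = {x. \<psi> x < \<infinity> \<and> (\<exists>A. alex_hessian \<psi> x A \<and> inj A)}"

text \<open>Gradient (exists at every point of X_psi).\<close>
definition grad :: "('a::euclidean_space \<Rightarrow> ereal) \<Rightarrow> 'a \<Rightarrow> 'a" where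
  "grad \<psi> x = (SOME g. ((\<lambda>y. real_of_ereal (\<psi> y)) has_derivative (\<lambda>v. inner g v)) (at x))"

text \<open>I(f, psi) = integral of f over X_psi (f positive, so a nonnegative Lebesgue integral).\<close>
definition Iint :: "('a::euclidean_space \<Rightarrow> real) \<Rightarrow> ('a \<Rightarrow> ereal) \<Rightarrow> ennreal" where
  "Iint f \<psi> = (\<integral>\<^sup>+ x. indicator (Xset \<psi>) x * ennreal (f x) \<partial>lebesgue)"

definition Fplus :: "('a::euclidean_space \<Rightarrow> ereal) \<Rightarrow> ('a \<Rightarrow> real) set" where
  "Fplus \<phi> = {g. set_borel_measurable lebesgue (Xset \<phi>) g \<and> (\<forall>y\<in>Xset \<phi>. 0 < g y)
                  \<and> 0 < Iint g \<phi> \<and> Iint g \<phi> < \<infinity>}"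

definition log_concave :: "('a::euclidean_space \<Rightarrow> real) \<Rightarrow> bool" where
  "log_concave G \<longleftrightarrow> (\<forall>x. 0 \<le> G x) \<and>
     (\<forall>x y. \<forall>t::real. 0 < t \<and> t < 1 \<longrightarrow>
        G x powr (1 - t) * G y powr t \<le> G ((1 - t) *\<^sub>R x + t *\<^sub>R y))"

definition Lclass :: "('a::euclidean_space \<Rightarrow> ereal) \<Rightarrow> ('a \<Rightarrow> real) set" where
  "Lclass \<phi> = {g \<in> Fplus \<phi>. \<exists>G. log_concave G \<and> (\<forall>y\<in>Xset \<phi>. G y = g y)}"

definition Vfun :: "(real \<Rightarrow> real) \<Rightarrow> (real \<Rightarrow> real) \<Rightarrow> (real \<Rightarrow> real)
      \<Rightarrow> ('a::euclidean_space \<Rightarrow> ereal) \<Rightarrow> ('a \<Rightarrow> real) \<Rightarrow> ennreal" where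
  "Vfun h F1 F2 \<psi> g = (\<integral>\<^sup>+ x. indicator (Xset \<psi>) x *
      ennreal (h (g (grad \<psi> x) / F2 (inner x (grad \<psi> x) - real_of_ereal (\<psi> x)))
               * F1 (real_of_ereal (\<psi> x))) \<partial>lebesgue)"

definition normalize :: "('a::euclidean_space \<Rightarrow> real) \<Rightarrow> ('a \<Rightarrow> ereal) \<Rightarrow> 'a \<Rightarrow> real" where
  "normalize g \<phi> = (\<lambda>y. (sqrt (2 * pi)) ^ DIM('a) * g y / enn2real (Iint g \<phi>))"

definition strict_convex_on :: "real set \<Rightarrow> (real \<Rightarrow> real) \<Rightarrow> bool" where
  "strict_convex_on S f \<longleftrightarrow> (\<forall>x\<in>S. \<forall>y\<in>S. x \<noteq> y \<longrightarrow> (\<forall>t::real. 0 < t \<and> t < 1 \<longrightarrow>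
       f ((1 - t) * x + t * y) < (1 - t) * f x + t * f y))"

definition strict_concave_on :: "real set \<Rightarrow> (real \<Rightarrow> real) \<Rightarrow> bool" where
  "strict_concave_on S f \<longleftrightarrow> strict_convex_on S (\<lambda>x. - f x)"

definition admissible :: "(real \<Rightarrow> real) \<Rightarrow> bool" where
  "admissible h \<longleftrightarrow> continuous_on {0<..} h \<and> (\<forall>t>0. 0 < h t)"

definition PhiC :: "(real \<Rightarrow> real) \<Rightarrow> bool" where
  "PhiC h \<longleftrightarrow> admissible h \<and> ((\<exists>c. \<forall>t>0. h t = c) \<or> strict_convex_on {0<..} h)"

definition PsiC :: "(real \<Rightarrow> real) \<Rightarrow> bool" where
  "PsiC h \<longleftrightarrow> admissible h \<and> ((\<exists>c. \<forall>t>0. h t = c) \<or>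
      (mono_on {0<..} h \<and> strict_concave_on {0<..} h))"

text \<open>as^orlicz: inf over F^+ for h in Phi, sup for h in Psi (a constant h lies in both;
  then V does not depend on g).\<close>
definition as_orlicz :: "(real \<Rightarrow> real) \<Rightarrow> (real \<Rightarrow> real) \<Rightarrow> (real \<Rightarrow> real)
      \<Rightarrow> ('a::euclidean_space \<Rightarrow> ereal) \<Rightarrow> ennreal" where
  "as_orlicz h F1 F2 \<psi> =
     (if PhiC h then (INF g\<in>Fplus (legendre \<psi>). Vfun h F1 F2 \<psi> (normalize g (legendre \<psi>)))
      else (SUP g\<in>Fplus (legendre \<psi>). Vfun h F1 F2 \<psi> (normalize g (legendre \<psi>))))"

definition G_orlicz :: "(real \<Rightarrow> real) \<Rightarrow> (real \<Rightarrow> real) \<Rightarrow> (real \<Rightarrow> real)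
      \<Rightarrow> ('a::euclidean_space \<Rightarrow> ereal) \<Rightarrow> ennreal" where
  "G_orlicz h F1 F2 \<psi> =
     (if PhiC h then (INF g\<in>Lclass (legendre \<psi>). Vfun h F1 F2 \<psi> (normalize g (legendre \<psi>)))
      else (SUP g\<in>Lclass (legendre \<psi>). Vfun h F1 F2 \<psi> (normalize g (legendre \<psi>))))"

end

theory Submission
  imports Defs
begin

text \<open>
  Write \<open>I\<close> for the integral of \<open>F1 \<circ> \<psi>\<close> over \<open>Xset \<psi>\<close> and \<open>m\<close> for the ratio of the \<open>h1\<close>-area to \<open>I\<close>.
  In the concave and convex cases the line supporting \<open>H\<close> at \<open>m\<close> compares \<open>h t\<close> with an affine
  function of \<open>h1 t\<close>. Integrating this comparison, and moving terms so that all coefficients are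
  nonnegative and infinite integrals cause no trouble, bounds \<open>Vfun h\<close> by \<open>Vfun h1\<close> for every \<open>g\<close>.
  The sign of the slope then lets the infimum or supremum over \<open>g\<close> pass through.
  In the remaining cases the test function \<open>g = F2 \<circ> legendre \<psi>\<close> makes the argument of \<open>h\<close> and \<open>h1\<close>
  constant, because \<open>legendre \<psi> (grad \<psi> x) = inner x (grad \<psi> x) - \<psi> x\<close>.

  Integrating requires the integrands to be positive and measurable. For this one shows that \<open>grad \<psi>\<close>
  maps \<open>Xset \<psi>\<close> into \<open>Xset (legendre \<psi>)\<close> with inverse \<open>grad (legendre \<psi>)\<close>, that both gradients are
  pointwise Lipschitz, hence continuous and null-set preserving, and that \<open>Xset \<psi>\<close> is Borel.
\<close>

section \<open>Second-order expansions of convex functions\<close>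

text \<open>The part of \<open>convC\<close> that passes to the conjugate, stated as real convexity
  on the effective domain; nothing is said about the interior of that domain.\<close>

definition econvex :: "('a::euclidean_space \<Rightarrow> ereal) \<Rightarrow> bool" where
  "econvex \<psi> \<longleftrightarrow> (\<forall>x. \<psi> x \<noteq> -\<infinity>) \<and> convex_on {x. \<psi> x < \<infinity>} (\<lambda>x. real_of_ereal (\<psi> x))"

text \<open>Free of division, so the bound includes \<open>y = x\<close> and can be used without
  excluding that point.\<close>

definition second_order ::
    "('a::euclidean_space \<Rightarrow> real) \<Rightarrow> 'a \<Rightarrow> 'a \<Rightarrow> ('a \<Rightarrow> 'a) \<Rightarrow> bool" where
  "second_order f x g A \<longleftrightarrow> (\<forall>e>0. \<exists>d>0. \<forall>y. norm (y - x) < d \<longrightarrow>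
     \<bar>f y - f x - inner g (y - x) - (1/2) * inner (A (y - x)) (y - x)\<bar> \<le> e * (norm (y - x))\<^sup>2)"

lemma econvexI_ineq:
  fixes \<psi> :: "'a::euclidean_space \<Rightarrow> ereal"
  assumes "\<And>x. \<psi> x \<noteq> -\<infinity>"
    and *: "\<And>x y t::real. 0 \<le> t \<Longrightarrow> t \<le> 1 \<Longrightarrow>
          \<psi> ((1 - t) *\<^sub>R x + t *\<^sub>R y) \<le> ereal (1 - t) * \<psi> x + ereal t * \<psi> y"
  shows "econvex \<psi>"
proof -
  have key: "\<psi> (u *\<^sub>R x + v *\<^sub>R y) \<le> ereal (u * real_of_ereal (\<psi> x) + v * real_of_ereal (\<psi> y))"
    if "\<psi> x < \<infinity>" "\<psi> y < \<infinity>" "u \<ge> 0" "v \<ge> 0" "u + v = 1" for x y u v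
  proof -
    note xy = that
    have u: "u = 1 - v" using that by simp
    obtain a b where "\<psi> x = ereal a" "\<psi> y = ereal b"
      using xy(1,2) assms(1)[of x] assms(1)[of y]
      by (metis ereal_cases less_irrefl)
    then show ?thesis using *[of v x y] that by (simp add: u)
  qed
  show ?thesis unfolding econvex_def convex_on_def convex_def
  proof (intro conjI allI ballI impI)
    show "\<psi> x \<noteq> -\<infinity>" for x by fact
    show "u *\<^sub>R x + v *\<^sub>R y \<in> {x. \<psi> x < \<infinity>}"
      if "x \<in> {x. \<psi> x < \<infinity>}" "y \<in> {x. \<psi> x < \<infinity>}" "0 \<le> u" "0 \<le> v" "u + v = 1" for x y u v
      using key[of x y u v] that by auto
    show "real_of_ereal (\<psi> (u *\<^sub>R x + v *\<^sub>R y)) \<le> u * real_of_ereal (\<psi> x) + v * real_of_ereal (\<psi> y)"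
      if "x \<in> {x. \<psi> x < \<infinity>}" "y \<in> {x. \<psi> x < \<infinity>}" "0 \<le> u" "0 \<le> v" "u + v = 1" for x y u v
      using key[of x y u v] that assms(1)[of "u *\<^sub>R x + v *\<^sub>R y"]
      by (cases "\<psi> (u *\<^sub>R x + v *\<^sub>R y)") auto
  qed
qed

lemma convC_imp_econvex: "convC \<psi> \<Longrightarrow> econvex \<psi>"
  unfolding convC_def by (intro econvexI_ineq) auto

lemma econvex_ereal_real: "econvex \<psi> \<Longrightarrow> \<psi> x < \<infinity> \<Longrightarrow> \<psi> x = ereal (real_of_ereal (\<psi> x))"
  unfolding econvex_def by (cases "\<psi> x") auto

section \<open>Fenchel's inequality and convexity of the conjugate\<close>

lemma fenchel_le:
  assumes "econvex \<psi>" "\<psi> x < \<infinity>"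
  shows "ereal (inner x y - real_of_ereal (\<psi> x)) \<le> legendre \<psi> y"
proof -
  have "ereal (inner x y - real_of_ereal (\<psi> x)) = ereal (inner x y) - \<psi> x"
    by (subst econvex_ereal_real[OF assms]) simp
  then show ?thesis unfolding legendre_def by (simp only:) (rule SUP_upper, rule UNIV_I)
qed

lemma legendre_le:
  assumes "econvex \<psi>" "\<And>x. \<psi> x < \<infinity> \<Longrightarrow> inner x y - real_of_ereal (\<psi> x) \<le> c"
  shows "legendre \<psi> y \<le> ereal c"
  unfolding legendre_def
proof (rule SUP_least)
  fix x
  show "ereal (inner x y) - \<psi> x \<le> ereal c"
  proof (cases "\<psi> x < \<infinity>")
    case True
    then show ?thesis using assms(2)[OF True] econvex_ereal_real[OF assms(1) True]
      by (cases "\<psi> x") auto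
  qed auto
qed

text \<open>A supremum of affine functions is convex, and one point of finiteness of
  \<open>\<psi>\<close> keeps it above \<open>-\<infinity>\<close>.\<close>

lemma econvex_legendre:
  assumes "econvex \<psi>" "\<psi> x0 < \<infinity>"
  shows "econvex (legendre \<psi>)"
proof (rule econvexI_ineq)
  show ninf: "legendre \<psi> y \<noteq> -\<infinity>" for y
    using fenchel_le[OF assms, of y] by auto
  fix y z and t :: real assume t: "0 \<le> t" "t \<le> 1"
  show "legendre \<psi> ((1 - t) *\<^sub>R y + t *\<^sub>R z) \<le> ereal (1 - t) * legendre \<psi> y + ereal t * legendre \<psi> z"
  \<comment> \<open>The endpoints are separate because \<open>0 * \<infinity> = 0\<close> in
    \<open>ereal\<close>; for \<open>0 < t < 1\<close> an infinite value makes the right-hand side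
    infinite.\<close>
  proof (cases "t = 0 \<or> t = 1")
    case True
    then show ?thesis by (auto simp: zero_ereal_def[symmetric] one_ereal_def[symmetric])
  next
    case False
    then have t': "0 < t" "t < 1" using t by auto
    show ?thesis
    proof (cases "legendre \<psi> y = \<infinity> \<or> legendre \<psi> z = \<infinity>")
      case True
      then show ?thesis using t' ninf[of y] ninf[of z]
        by (cases "legendre \<psi> y"; cases "legendre \<psi> z") auto
    next
      case False
      then obtain a b where ab: "legendre \<psi> y = ereal a" "legendre \<psi> z = ereal b"
        using ninf[of y] ninf[of z] by (cases "legendre \<psi> y"; cases "legendre \<psi> z") auto
      have "legendre \<psi> ((1 - t) *\<^sub>R y + t *\<^sub>R z) \<le> ereal ((1 - t) * a + t * b)"
      proof (rule legendre_le[OF assms(1)])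
        fix x assume x: "\<psi> x < \<infinity>"
        have "(1-t) * (inner x y - real_of_ereal (\<psi> x)) \<le> (1-t) * a"
             "t * (inner x z - real_of_ereal (\<psi> x)) \<le> t * b"
          using fenchel_le[OF assms(1) x, of y] fenchel_le[OF assms(1) x, of z] t' ab
          by (auto intro!: mult_left_mono)
        then show "inner x ((1 - t) *\<^sub>R y + t *\<^sub>R z) - real_of_ereal (\<psi> x) \<le> (1 - t) * a + t * b"
          by (simp add: inner_add_right algebra_simps)
      qed
      then show ?thesis using ab by simp
    qed
  qed
qed

section \<open>Alexandrov expansions, gradients and subgradients\<close>

lemma second_order_iff_tendsto:
  fixes A :: "'a::euclidean_space \<Rightarrow> 'a"
  assumes "linear A"
  shows "second_order f x g A \<longleftrightarrow>
     ((\<lambda>y. (f y - f x - inner g (y - x) - (1/2) * inner (A (y - x)) (y - x)) / (norm (y - x))\<^sup>2) \<longlongrightarrow> 0) (at x)"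
    (is "_ \<longleftrightarrow> (?q \<longlongrightarrow> 0) (at x)")
proof -
  let ?r = "\<lambda>y. f y - f x - inner g (y - x) - (1/2) * inner (A (y - x)) (y - x)"
  have r0: "?r x = 0" using assms by (simp add: linear_0)
  have eq: "\<bar>?r y\<bar> \<le> e * (norm (y - x))\<^sup>2 \<longleftrightarrow> y = x \<or> \<bar>?q y\<bar> \<le> e" if "e > 0" for y e
    using r0 that by (cases "y = x") (auto simp: abs_divide pos_divide_le_eq)
  show ?thesis
  proof
    assume so: "second_order f x g A"
    show "(?q \<longlongrightarrow> 0) (at x)" unfolding LIM_def
    proof (intro allI impI)
      fix e :: real assume e: "e > 0"
      then obtain d where d: "d > 0" "\<And>y. norm (y - x) < d \<Longrightarrow> \<bar>?r y\<bar> \<le> (e/2) * (norm (y - x))\<^sup>2"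
        using so unfolding second_order_def by (meson half_gt_zero)
      have "\<bar>?q y\<bar> < e" if "y \<noteq> x" "dist y x < d" for y
      proof -
        have "\<bar>?q y\<bar> \<le> e/2" using d(2)[of y] eq[of "e/2" y] that e unfolding dist_norm by auto
        then show ?thesis using e by linarith
      qed
      then show "\<exists>s>0. \<forall>xa. xa \<noteq> x \<and> dist xa x < s \<longrightarrow> dist (?q xa) 0 < e"
        using d(1) by (intro exI[of _ d]) (simp del: abs_divide)
    qed
  next
    assume lim: "(?q \<longlongrightarrow> 0) (at x)"
    show "second_order f x g A" unfolding second_order_def
    proof (intro allI impI)
      fix e :: real assume e: "e > 0"
      obtain d where d: "d > 0" "\<And>y. y \<noteq> x \<and> dist y x < d \<Longrightarrow> dist (?q y) 0 < e"
        using lim e unfolding LIM_def by blast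
      have "\<bar>?r y\<bar> \<le> e * (norm (y - x))\<^sup>2" if "norm (y - x) < d" for y
      proof (cases "y = x")
        case False
        then have "\<bar>?q y\<bar> < e" using d(2)[of y] that by (simp add: dist_norm del: abs_divide)
        then show ?thesis using eq[OF e, of y] by linarith
      qed (use r0 in simp)
      then show "\<exists>d>0. \<forall>y. norm (y - x) < d \<longrightarrow> \<bar>?r y\<bar> \<le> e * (norm (y - x))\<^sup>2"
        using d(1) by blast
    qed
  qed
qed

lemma inner_linear_le:
  fixes A :: "'a::euclidean_space \<Rightarrow> 'a"
  assumes "linear A"
  obtains K where "K > 0" "\<And>v. norm (A v) \<le> K * norm v" "\<And>v. \<bar>inner (A v) v\<bar> \<le> K * (norm v)\<^sup>2"
proof -
  obtain K where K: "K > 0" "\<And>v. norm (A v) \<le> K * norm v"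
    using linear_bounded_pos[OF assms] by blast
  have "\<bar>inner (A v) v\<bar> \<le> K * (norm v)\<^sup>2" for v
  proof -
    have "\<bar>inner (A v) v\<bar> \<le> norm (A v) * norm v" by (rule Cauchy_Schwarz_ineq2)
    also have "\<dots> \<le> (K * norm v) * norm v" using K(2) by (intro mult_right_mono) auto
    finally show ?thesis by (simp add: power2_eq_square mult.assoc)
  qed
  with K that show ?thesis by blast
qed

lemma second_order_quadratic_bound:
  assumes "linear A" "second_order f x g A"
  obtains K d where "K > 0" "d > 0"
    "\<And>y. norm (y - x) < d \<Longrightarrow> \<bar>f y - f x - inner g (y - x)\<bar> \<le> K * (norm (y - x))\<^sup>2"
proof -
  obtain K where K: "K > 0" "\<And>v. \<bar>inner (A v) v\<bar> \<le> K * (norm v)\<^sup>2"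
    using inner_linear_le[OF assms(1)] by metis
  obtain d where d: "d > 0" "\<And>y. norm (y - x) < d \<Longrightarrow>
     \<bar>f y - f x - inner g (y - x) - (1/2) * inner (A (y - x)) (y - x)\<bar> \<le> 1 * (norm (y - x))\<^sup>2"
    using assms(2) unfolding second_order_def by (meson zero_less_one)
  have "\<bar>f y - f x - inner g (y - x)\<bar> \<le> (1 + K) * (norm (y - x))\<^sup>2" if "norm (y - x) < d" for y
    using d(2)[OF that] K(2)[of "y - x"] by (simp add: algebra_simps abs_le_iff)
  then show ?thesis using that[of "1 + K" d] K d by auto
qed

lemma quadratic_bound_has_derivative:
  fixes f :: "'a::euclidean_space \<Rightarrow> real"
  assumes K: "K > 0" "d > 0"
    "\<And>y. norm (y - x) < d \<Longrightarrow> \<bar>f y - f x - inner g (y - x)\<bar> \<le> K * (norm (y - x))\<^sup>2"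
  shows "(f has_derivative (\<lambda>v. inner g v)) (at x)"
  unfolding has_derivative_at_alt
proof (intro conjI allI impI)
  show "bounded_linear (inner g)" by (rule bounded_linear_inner_right)
  fix e :: real assume e: "e > 0"
  show "\<exists>d>0. \<forall>y. norm (y - x) < d \<longrightarrow> norm (f y - f x - inner g (y - x)) \<le> e * norm (y - x)"
  proof (intro exI[of _ "min d (e / K)"] conjI allI impI)
    show "0 < min d (e / K)" using K e by auto
    fix y assume y: "norm (y - x) < min d (e / K)"
    then have "K * norm (y - x) \<le> e" using K by (simp add: pos_less_divide_eq mult.commute)
    then have "(K * norm (y - x)) * norm (y - x) \<le> e * norm (y - x)" by (intro mult_right_mono) auto
    then show "norm (f y - f x - inner g (y - x)) \<le> e * norm (y - x)"
      using K(3)[of y] y by (simp add: power2_eq_square mult.assoc)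
  qed
qed

lemma inner_has_derivative_unique:
  assumes "(f has_derivative (\<lambda>v. inner g v)) (at x)" "(f has_derivative (\<lambda>v. inner g' v)) (at x)"
  shows "g = g'"
  using has_derivative_unique[OF assms] by (metis vector_eq_rdot)

lemma grad_eqI:
  assumes "((\<lambda>y. real_of_ereal (\<psi> y)) has_derivative (\<lambda>v. inner g v)) (at x)"
  shows "grad \<psi> x = g"
  unfolding grad_def
  by (rule some_equality, rule assms) (rule inner_has_derivative_unique[OF _ assms])

text \<open>The linear term in \<open>alex_hessian\<close> is only asserted to exist, while
  \<open>grad\<close> is chosen separately. An expansion forces differentiability, so uniqueness of
  the derivative identifies the two.\<close>

lemma XsetE:
  assumes "x \<in> Xset \<psi>"
  obtains A where "linear A" "\<And>u v. inner (A u) v = inner u (A v)" "inj A"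
    "x \<in> interior {y. \<psi> y < \<infinity>}" "second_order (\<lambda>y. real_of_ereal (\<psi> y)) x (grad \<psi> x) A"
proof -
  obtain A g where A: "linear A" "\<And>u v. inner (A u) v = inner u (A v)" "inj A"
    "x \<in> interior {y. \<psi> y < \<infinity>}" "second_order (\<lambda>y. real_of_ereal (\<psi> y)) x g A"
    using assms second_order_iff_tendsto unfolding Xset_def alex_hessian_def by blast
  obtain K d where "K > 0" "d > 0"
    "\<And>y. norm (y - x) < d \<Longrightarrow>
      \<bar>real_of_ereal (\<psi> y) - real_of_ereal (\<psi> x) - inner g (y - x)\<bar> \<le> K * (norm (y - x))\<^sup>2"
    using second_order_quadratic_bound[OF A(1,5)] by blast
  then have "grad \<psi> x = g" by (intro grad_eqI quadratic_bound_has_derivative)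
  with A that show ?thesis by blast
qed

lemma XsetI:
  assumes A: "linear A" "\<And>u v. inner (A u) v = inner u (A v)" "inj A"
    and x: "x \<in> interior {y. \<psi> y < \<infinity>}" and so: "second_order (\<lambda>y. real_of_ereal (\<psi> y)) x g A"
  shows "x \<in> Xset \<psi>" "grad \<psi> x = g"
proof -
  have "alex_hessian \<psi> x A" unfolding alex_hessian_def
    using A x so[unfolded second_order_iff_tendsto[OF A(1)]] by blast
  then show "x \<in> Xset \<psi>" unfolding Xset_def using A x interior_subset by blast
  show "grad \<psi> x = g"
    by (rule second_order_quadratic_bound[OF A(1) so])
      (intro grad_eqI quadratic_bound_has_derivative)
qed

text \<open>Convexity along the segment from \<open>x\<close> to \<open>y\<close> bounds the
  difference quotient at a short step \<open>t\<close> by \<open>f y - f x\<close>. At that step the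
  quotient is the linear term up to \<open>t\<close> times a constant.\<close>

lemma convex_quadratic_bound_subgradient:
  fixes f :: "'a::euclidean_space \<Rightarrow> real"
  assumes cf: "convex_on D f" and xy: "x \<in> D" "y \<in> D"
    and K: "K > 0" "d > 0"
    "\<And>y. norm (y - x) < d \<Longrightarrow> \<bar>f y - f x - inner g (y - x)\<bar> \<le> K * (norm (y - x))\<^sup>2"
  shows "f x + inner g (y - x) \<le> f y"
proof (rule field_le_epsilon)
  fix e :: real assume e: "e > 0"
  define v where "v = y - x"
  \<comment> \<open>The second entry keeps the step inside the radius \<open>d\<close>, the third
    makes the quadratic error at most \<open>e\<close> after division by \<open>t\<close>; the added
    ones guard against \<open>v = 0\<close>.\<close>
  define t where "t = min 1 (min (d / (2 * (norm v + 1))) (e / (K * (norm v)\<^sup>2 + 1)))"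
  have nn: "0 < norm v + 1" "0 < K * (norm v)\<^sup>2 + 1"
    using K by (auto simp: add_nonneg_pos)
  then have t: "0 < t" "t \<le> 1" "t \<le> d / (2 * (norm v + 1))" "t \<le> e / (K * (norm v)\<^sup>2 + 1)"
    using K e by (auto simp: t_def)
  have "t * norm v < d"
  proof -
    have "t * (norm v + 1) \<le> d / 2" using t(3) nn by (simp add: field_simps)
    then show ?thesis using t K by (simp add: algebra_simps)
  qed
  then have lo: "\<bar>f (x + t *\<^sub>R v) - f x - inner g (t *\<^sub>R v)\<bar> \<le> K * (norm (t *\<^sub>R v))\<^sup>2"
    using K(3)[of "x + t *\<^sub>R v"] t by simp
  have "f ((1 - t) *\<^sub>R x + t *\<^sub>R y) \<le> (1 - t) * f x + t * f y"
    using convex_onD[OF cf, of t x y] t xy by simp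
  moreover have "(1 - t) *\<^sub>R x + t *\<^sub>R y = x + t *\<^sub>R v" by (simp add: v_def algebra_simps)
  ultimately have "t * inner g v - K * (t\<^sup>2 * (norm v)\<^sup>2) \<le> t * (f y - f x)"
    using lo t by (simp add: abs_le_iff power_mult_distrib algebra_simps)
  then have "t * (inner g v - t * (K * (norm v)\<^sup>2)) \<le> t * (f y - f x)"
    by (simp add: power2_eq_square algebra_simps)
  then have "inner g v - t * (K * (norm v)\<^sup>2) \<le> f y - f x" using t by simp
  moreover have "t * (K * (norm v)\<^sup>2) \<le> e"
  proof -
    have "t * (K * (norm v)\<^sup>2 + 1) \<le> e" using t(4) nn by (simp add: pos_le_divide_eq)
    then show ?thesis using t by (simp add: algebra_simps)
  qed
  ultimately show "f x + inner g (y - x) \<le> f y + e" unfolding v_def by linarith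
qed

lemma Xset_subgradient:
  assumes "econvex \<psi>" "x \<in> Xset \<psi>" "\<psi> y < \<infinity>"
  shows "real_of_ereal (\<psi> x) + inner (grad \<psi> x) (y - x) \<le> real_of_ereal (\<psi> y)"
proof -
  obtain A where A: "linear A" "second_order (\<lambda>y. real_of_ereal (\<psi> y)) x (grad \<psi> x) A"
    using XsetE[OF assms(2)] by metis
  obtain K d where K: "K > 0" "d > 0"
    "\<And>y. norm (y - x) < d \<Longrightarrow>
      \<bar>real_of_ereal (\<psi> y) - real_of_ereal (\<psi> x) - inner (grad \<psi> x) (y - x)\<bar> \<le> K * (norm (y - x))\<^sup>2"
    using second_order_quadratic_bound[OF A] by blast
  show ?thesis
    using assms
    by (intro convex_quadratic_bound_subgradient[OF _ _ _ K, where D = "{x. \<psi> x < \<infinity>}"])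
      (auto simp: econvex_def Xset_def)
qed

text \<open>The equality case of Fenchel's inequality: the subgradient inequality says that
  \<open>x\<close> is a maximiser in the supremum.\<close>

lemma legendre_grad:
  assumes "econvex \<psi>" "x \<in> Xset \<psi>"
  shows "legendre \<psi> (grad \<psi> x) = ereal (inner x (grad \<psi> x) - real_of_ereal (\<psi> x))"
proof (rule antisym)
  show "legendre \<psi> (grad \<psi> x) \<le> ereal (inner x (grad \<psi> x) - real_of_ereal (\<psi> x))"
  proof (rule legendre_le[OF assms(1)])
    fix y assume "\<psi> y < \<infinity>"
    from Xset_subgradient[OF assms this]
    show "inner y (grad \<psi> x) - real_of_ereal (\<psi> y) \<le> inner x (grad \<psi> x) - real_of_ereal (\<psi> x)"
      by (simp add: inner_diff_right inner_commute)
  qed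
  show "ereal (inner x (grad \<psi> x) - real_of_ereal (\<psi> x)) \<le> legendre \<psi> (grad \<psi> x)"
    using assms by (intro fenchel_le) (auto simp: Xset_def)
qed

text \<open>Testing the subgradient at \<open>y\<close> in the direction \<open>grad \<psi> y - grad \<psi> x\<close> over the distance
  \<open>norm (y - x)\<close> turns the quadratic bound at \<open>x\<close> into a Lipschitz bound at \<open>x\<close>.\<close>

lemma grad_pointwise_Lipschitz:
  assumes cv: "econvex \<psi>" and x: "x \<in> Xset \<psi>"
  obtains T B where "open T" "x \<in> T" "B \<ge> 0"
    "\<And>y. y \<in> Xset \<psi> \<inter> T \<Longrightarrow> norm (grad \<psi> y - grad \<psi> x) \<le> B * norm (y - x)"
proof -
  define f where "f = (\<lambda>y. real_of_ereal (\<psi> y))"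
  define g where "g = grad \<psi> x"
  obtain A where A: "linear A" "x \<in> interior {y. \<psi> y < \<infinity>}" "second_order f x g A"
    using XsetE[OF x] unfolding f_def g_def by metis
  obtain K d where K: "K > 0" "d > 0"
    "\<And>y. norm (y - x) < d \<Longrightarrow> \<bar>f y - f x - inner g (y - x)\<bar> \<le> K * (norm (y - x))\<^sup>2"
    using second_order_quadratic_bound[OF A(1,3)] by blast
  obtain r where r: "r > 0" "ball x r \<subseteq> {y. \<psi> y < \<infinity>}"
    using A(2) by (meson mem_interior)
  \<comment> \<open>The halving leaves room for the test point \<open>z\<close>, which may be twice
    as far from \<open>x\<close> as \<open>y\<close> is.\<close>
  define s where "s = min d r / 2"
  have s: "s > 0" "2 * s \<le> d" "2 * s \<le> r" using K r by (auto simp: s_def)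
  \<comment> \<open>The 5 is 4 + 1: the quadratic bound is used at \<open>z\<close>, within distance
    \<open>2 * \<rho>\<close> of \<open>x\<close>, and at \<open>y\<close>, at distance
    \<open>\<rho>\<close>.\<close>
  have "norm (grad \<psi> y - g) \<le> 5 * K * norm (y - x)" if y: "y \<in> Xset \<psi> \<inter> ball x s" for y
  proof (cases "grad \<psi> y = g \<or> y = x")
    case True
    then show ?thesis using K by (auto simp: g_def)
  next
    case False
    define p where "p = grad \<psi> y"
    define \<rho> where "\<rho> = norm (y - x)"
    define e where "e = (p - g) /\<^sub>R norm (p - g)"
    have \<rho>: "\<rho> > 0" "\<rho> < s" using False y by (auto simp: \<rho>_def dist_norm norm_minus_commute)
    have ne: "norm e = 1" "inner (p - g) e = norm (p - g)"
      using False unfolding e_def p_def by (auto simp: power2_norm_eq_inner[symmetric] power2_eq_square)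
    define z where "z = y + \<rho> *\<^sub>R e"
    have "norm (z - x) \<le> norm (y - x) + norm (\<rho> *\<^sub>R e)"
      unfolding z_def by (metis add_diff_eq add.commute norm_triangle_ineq)
    then have nz: "norm (z - x) \<le> 2 * \<rho>" using ne \<rho> by (simp add: \<rho>_def)
    then have zr: "norm (z - x) < d" "z \<in> ball x r"
      using s \<rho> by (auto simp: dist_norm norm_minus_commute)
    then have "\<psi> z < \<infinity>" using r by auto
    then have 1: "f y + inner p (z - y) \<le> f z"
      using Xset_subgradient[OF cv, of y z] y unfolding f_def p_def by auto
    have 2: "f z - f x - inner g (z - x) \<le> K * (2 * \<rho>)\<^sup>2"
    proof -
      have "f z - f x - inner g (z - x) \<le> K * (norm (z - x))\<^sup>2"
        using K(3)[OF zr(1)] by simp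
      also have "\<dots> \<le> K * (2 * \<rho>)\<^sup>2"
        using nz K by (intro mult_left_mono power_mono) auto
      finally show ?thesis .
    qed
    have 3: "- (K * \<rho>\<^sup>2) \<le> f y - f x - inner g (y - x)"
      using K(3)[of y] \<rho> s unfolding \<rho>_def by (simp add: abs_le_iff)
    have "\<rho> * norm (p - g) = inner p (z - y) - inner g (z - y)"
      using ne(2) by (simp add: z_def inner_diff_left algebra_simps flip: ne(2))
    also have "\<dots> \<le> 5 * K * \<rho>\<^sup>2"
      using 1 2 3 by (simp add: inner_diff_right power_mult_distrib)
    finally have "norm (p - g) \<le> 5 * K * \<rho>" using \<rho> by (simp add: power2_eq_square)
    then show ?thesis by (simp add: p_def \<rho>_def)
  qed
  then show ?thesis using that[of "ball x s" "5 * K"] s K unfolding g_def by auto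
qed

lemma continuous_on_grad:
  assumes "econvex \<psi>" shows "continuous_on (Xset \<psi>) (grad \<psi>)"
  unfolding continuous_on_iff
proof (intro ballI allI impI)
  fix x and e :: real assume x: "x \<in> Xset \<psi>" and e: "e > 0"
  obtain T B where T: "open T" "x \<in> T" "B \<ge> 0"
    "\<And>y. y \<in> Xset \<psi> \<inter> T \<Longrightarrow> norm (grad \<psi> y - grad \<psi> x) \<le> B * norm (y - x)"
    using grad_pointwise_Lipschitz[OF assms x] by blast
  obtain r where r: "r > 0" "ball x r \<subseteq> T" using T by (meson openE)
  show "\<exists>d>0. \<forall>y\<in>Xset \<psi>. dist y x < d \<longrightarrow> dist (grad \<psi> y) (grad \<psi> x) < e"
  \<comment> \<open>\<open>B\<close> may be 0, hence the divisor \<open>B + 1\<close>.\<close>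
  proof (intro exI[of _ "min r (e / (B + 1))"] conjI ballI impI)
    show "0 < min r (e / (B + 1))" using r e T by auto
    fix y assume y: "y \<in> Xset \<psi>" "dist y x < min r (e / (B + 1))"
    then have "norm (grad \<psi> y - grad \<psi> x) \<le> B * norm (y - x)"
      using T r by (auto simp: dist_commute subset_iff)
    moreover have "(B + 1) * norm (y - x) < e" using y T
      by (auto simp: dist_norm pos_less_divide_eq mult.commute)
    ultimately show "dist (grad \<psi> y) (grad \<psi> x) < e"
      by (simp add: dist_norm algebra_simps) (smt (verit) norm_ge_zero)
  qed
qed

lemma negligible_grad_image:
  assumes "econvex \<psi>" "negligible S" "S \<subseteq> Xset \<psi>"
  shows "negligible (grad \<psi> ` S)"
proof (rule negligible_locally_Lipschitz_image[OF order_refl assms(2)])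
  fix x assume "x \<in> S"
  then have x: "x \<in> Xset \<psi>" using assms(3) by blast
  show "\<exists>T B. open T \<and> x \<in> T \<and> (\<forall>y\<in>S \<inter> T. norm (grad \<psi> y - grad \<psi> x) \<le> B * norm (y - x))"
  proof (rule grad_pointwise_Lipschitz[OF assms(1) x])
    fix T B
    assume "open T" "x \<in> T"
      "\<And>y. y \<in> Xset \<psi> \<inter> T \<Longrightarrow> norm (grad \<psi> y - grad \<psi> x) \<le> B * norm (y - x)"
    then show ?thesis
      using assms(3) by (intro exI[of _ T] exI[of _ B]) auto
  qed
qed

section \<open>The Hessian of the conjugate\<close>

text \<open>Nonnegativity of the form at \<open>v - (1/K) *\<^sub>R A v\<close>, with
  \<open>K\<close> an operator bound, yields
  \<open>(norm (A v))\<^sup>2 / K \<le> inner (A v) v\<close>. Injectivity bounds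
  \<open>norm (A v)\<close> below, and no diagonalisation is involved.\<close>

lemma positive_semidefinite_inj_coercive:
  fixes A :: "'a::euclidean_space \<Rightarrow> 'a"
  assumes A: "linear A" "\<And>u v. inner (A u) v = inner u (A v)" "inj A"
    and psd: "\<And>v. 0 \<le> inner (A v) v"
  obtains m where "m > 0" "\<And>v. m * (norm v)\<^sup>2 \<le> inner (A v) v"
proof -
  obtain K where K: "K > 0" "\<And>v. norm (A v) \<le> K * norm v" "\<And>v. \<bar>inner (A v) v\<bar> \<le> K * (norm v)\<^sup>2"
    using inner_linear_le[OF A(1)] by blast
  obtain b where b: "b > 0" "\<And>v. b * norm v \<le> norm (A v)"
    using linear_inj_bounded_below_pos[OF A(1,3)] by (metis mult.commute)
  have "(b\<^sup>2 / K) * (norm v)\<^sup>2 \<le> inner (A v) v" for v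
  proof -
    have "0 \<le> inner (A (v - (1/K) *\<^sub>R A v)) (v - (1/K) *\<^sub>R A v)" by (rule psd)
    also have "\<dots> = inner (A v) v - (2/K) * (norm (A v))\<^sup>2 + (1/K)\<^sup>2 * inner (A (A v)) (A v)"
      using A(2)[of "A v" v] A(1)
      by (simp add: linear_diff linear_scale inner_diff_left inner_diff_right power2_eq_square
          algebra_simps flip: power2_norm_eq_inner)
    also have "\<dots> \<le> inner (A v) v - (2/K) * (norm (A v))\<^sup>2 + (1/K)\<^sup>2 * (K * (norm (A v))\<^sup>2)"
      using K(3)[of "A v"] by (intro add_left_mono mult_left_mono) auto
    also have "\<dots> = inner (A v) v - (norm (A v))\<^sup>2 / K"
      using K(1) by (simp add: power2_eq_square field_simps)
    finally have "(norm (A v))\<^sup>2 / K \<le> inner (A v) v" by simp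
    moreover have "(b * norm v)\<^sup>2 / K \<le> (norm (A v))\<^sup>2 / K"
      using b K by (intro divide_right_mono power_mono) auto
    ultimately show ?thesis by (simp add: power_mult_distrib)
  qed
  then show ?thesis using that[of "b\<^sup>2 / K"] b K by simp
qed

text \<open>Above its tangent, \<open>f\<close> has nonnegative remainder along
  \<open>x + t *\<^sub>R v\<close>. That remainder is half the quadratic form up to a small multiple
  of \<open>t\<^sup>2\<close>, which can be divided out.\<close>

lemma second_order_min_psd:
  fixes A :: "'a::euclidean_space \<Rightarrow> 'a"
  assumes A: "linear A" and so: "second_order f x g A"
    and r: "r > 0" and ge: "\<And>y. norm (y - x) < r \<Longrightarrow> f x + inner g (y - x) \<le> f y"
  shows "0 \<le> inner (A v) v"
proof (cases "v = 0")
  case False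
  show ?thesis
  proof (rule field_le_epsilon)
    fix e :: real assume e: "e > 0"
    define e' where "e' = e / (2 * (norm v)\<^sup>2)"
    have e': "e' > 0" using e False by (simp add: e'_def)
    obtain d where d: "d > 0" "\<And>y. norm (y - x) < d \<Longrightarrow>
       \<bar>f y - f x - inner g (y - x) - (1/2) * inner (A (y - x)) (y - x)\<bar> \<le> e' * (norm (y - x))\<^sup>2"
      using so e' unfolding second_order_def by blast
    define t where "t = min d r / (2 * norm v)"
    have t: "t > 0" using d r False by (simp add: t_def)
    have "t * norm v = min d r / 2" using False by (simp add: t_def)
    then have tv: "t * norm v < d" "t * norm v < r" using d r by auto
    have "0 \<le> f (x + t *\<^sub>R v) - f x - inner g (t *\<^sub>R v)"
      using ge[of "x + t *\<^sub>R v"] tv t by simp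
    moreover have "f (x + t *\<^sub>R v) - f x - inner g (t *\<^sub>R v) - (1/2) * inner (A (t *\<^sub>R v)) (t *\<^sub>R v)
        \<le> e' * (norm (t *\<^sub>R v))\<^sup>2"
      using d(2)[of "x + t *\<^sub>R v"] tv t by (simp add: abs_le_iff)
    ultimately have "0 \<le> (1/2) * inner (A (t *\<^sub>R v)) (t *\<^sub>R v) + e' * (norm (t *\<^sub>R v))\<^sup>2"
      by linarith
    also have "\<dots> = t\<^sup>2 * ((1/2) * inner (A v) v + e' * (norm v)\<^sup>2)"
      by (simp add: linear_scale[OF A] power2_eq_square algebra_simps)
    finally have "0 \<le> (1/2) * inner (A v) v + e' * (norm v)\<^sup>2"
      using t by (simp add: zero_le_mult_iff)
    then show "0 \<le> inner (A v) v + e" using False by (simp add: e'_def)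
  qed
qed simp

text \<open>Writing \<open>\<psi>\<close> near \<open>x\<close> as its tangent plus half the quadratic form of \<open>A\<close>, the supremum defining
  the conjugate near \<open>grad \<psi> x\<close> is attained close to \<open>x\<close> by coercivity and convexity, so that it is
  the conjugate quadratic form, that of the inverse of \<open>A\<close>, up to second order.\<close>

lemma Xset_legendre:
  fixes \<psi> :: "'a::euclidean_space \<Rightarrow> ereal"
  assumes cv: "econvex \<psi>" and x: "x \<in> Xset \<psi>"
  shows "grad \<psi> x \<in> Xset (legendre \<psi>)" "grad (legendre \<psi>) (grad \<psi> x) = x"
proof -
  define f where "f = (\<lambda>y. real_of_ereal (\<psi> y))"
  define g where "g = grad \<psi> x"
  define c where "c = inner x g - f x"
  obtain A where A: "linear A" "\<And>u v. inner (A u) v = inner u (A v)" "inj A"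
    and xi: "x \<in> interior {y. \<psi> y < \<infinity>}" and so: "second_order f x g A"
    using XsetE[OF x] unfolding f_def g_def by blast
  have cf: "convex_on {y. \<psi> y < \<infinity>} f" using cv by (simp add: econvex_def f_def)
  obtain r where r: "r > 0" "ball x r \<subseteq> {y. \<psi> y < \<infinity>}" using xi by (meson mem_interior)
  have dom: "\<psi> y < \<infinity>" if "norm (y - x) < r" for y
    using r that by (auto simp: dist_norm norm_minus_commute subset_iff)
  have xf: "\<psi> x < \<infinity>" using dom[of x] r by simp
  have sub: "f x + inner g (y - x) \<le> f y" if "\<psi> y < \<infinity>" for y
    using Xset_subgradient[OF cv x that] by (simp add: f_def g_def)
  have psd: "0 \<le> inner (A v) v" for v
    using second_order_min_psd[OF A(1) so r(1)] sub dom by blast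
  obtain m where m: "m > 0" "\<And>v. m * (norm v)\<^sup>2 \<le> inner (A v) v"
    using positive_semidefinite_inj_coercive[OF A psd] by blast
  obtain B where B: "linear B" "\<And>v. B (A v) = v" "\<And>v. A (B v) = v"
    using linear_injective_isomorphism[OF A(1,3)] by blast
  have Bsym: "inner (B u) v = inner u (B v)" for u v
    using A(2)[of "B u" "B v"] by (simp add: B)
  have Binj: "inj B" by (metis B(3) injI)
  have Bpsd: "0 \<le> inner (B v) v" for v using psd[of "B v"] by (simp add: B inner_commute)
  obtain L where L: "L > 0" "\<And>v. norm (B v) \<le> L * norm v" using inner_linear_le[OF B(1)] by metis
  \<comment> \<open>Young's inequality for the form of \<open>A\<close>, by completing the square
    around the maximiser \<open>B w\<close>.\<close>
  have quad: "inner z w - (1/2) * inner (A z) z \<le> (1/2) * inner (B w) w" for z w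
  proof -
    have "0 \<le> inner (A (z - B w)) (z - B w)" by (rule psd)
    also have "\<dots> = inner (A z) z - 2 * inner z w + inner (B w) w"
      using A(2)[of z "B w"] A(1)
      by (simp add: linear_diff B inner_diff_left inner_diff_right inner_commute algebra_simps)
    finally show ?thesis by simp
  qed
  have upper: "\<exists>d>0. \<forall>w. norm w < d \<longrightarrow>
      legendre \<psi> (g + w) \<le> ereal (c + inner x w + (1/2) * inner (B w) w + e * (norm w)\<^sup>2)"
    if e: "e > 0" for e
  proof -
    \<comment> \<open>The first bound leaves growth \<open>m/2 - m/4 = m/4\<close> above the
      tangent. The second turns an error at \<open>z\<close> into one at \<open>w\<close>, since
      relevant \<open>z\<close> will satisfy \<open>norm z \<le> (4/m) * norm w\<close>.\<close>
    define e1 where "e1 = min (m/4) (e * m\<^sup>2 / 16)"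
    have e1: "e1 > 0" "e1 \<le> m/4" "e1 \<le> e * m\<^sup>2 / 16" using m e by (auto simp: e1_def)
    obtain d where d: "d > 0" "\<And>y. norm (y - x) < d \<Longrightarrow>
       \<bar>f y - f x - inner g (y - x) - (1/2) * inner (A (y - x)) (y - x)\<bar> \<le> e1 * (norm (y - x))\<^sup>2"
      using so e1(1) unfolding second_order_def by blast
    define s where "s = min d r / 2"
    have s: "0 < s" "s < d" "s < r" using d r by (auto simp: s_def)
    have near: "f x + inner g z + (1/2) * inner (A z) z - e1 * (norm z)\<^sup>2 \<le> f (x + z)"
      if "norm z < d" for z
      using d(2)[of "x + z"] that by (simp add: abs_le_iff)
    have near': "f x + inner g z + (m/4) * (norm z)\<^sup>2 \<le> f (x + z)" if "norm z < d" for z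
    proof -
      have "e1 * (norm z)\<^sup>2 \<le> (m/4) * (norm z)\<^sup>2" using e1 by (intro mult_right_mono) auto
      then show ?thesis using near[OF that] m(2)[of z] by linarith
    qed
    \<comment> \<open>Convexity propagates the quadratic growth at radius \<open>s\<close> outward
      as linear growth of slope \<open>(m/4) * s\<close>, including at points where the expansion
      says nothing.\<close>
    have far: "f x + inner g z + (m/4) * s * norm z \<le> f (x + z)"
      if z: "s \<le> norm z" "\<psi> (x + z) < \<infinity>" for z
    proof -
      define t where "t = s / norm z"
      have nz: "0 < norm z" using z s by linarith
      have t: "0 < t" "t \<le> 1" "t * norm z = s" using nz z s by (auto simp: t_def)
      have "f ((1 - t) *\<^sub>R x + t *\<^sub>R (x + z)) \<le> (1 - t) * f x + t * f (x + z)"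
        using convex_onD[OF cf, of t x "x + z"] t z xf by simp
      moreover have "(1 - t) *\<^sub>R x + t *\<^sub>R (x + z) = x + t *\<^sub>R z" by (simp add: algebra_simps)
      moreover have "f x + inner g (t *\<^sub>R z) + (m/4) * (norm (t *\<^sub>R z))\<^sup>2 \<le> f (x + t *\<^sub>R z)"
        using near'[of "t *\<^sub>R z"] t s by simp
      ultimately have "t * inner g z + (m/4) * (norm (t *\<^sub>R z))\<^sup>2 \<le> t * (f (x + z) - f x)"
        by (simp add: algebra_simps)
      moreover have "(norm (t *\<^sub>R z))\<^sup>2 = t * (s * norm z)"
        using t by (simp add: power2_eq_square)
      ultimately have "t * (inner g z + (m/4) * s * norm z) \<le> t * (f (x + z) - f x)"
        by (simp add: algebra_simps)
      then show ?thesis using t by simp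
    qed
    show ?thesis
    \<comment> \<open>The radius is the slope of the linear growth: for smaller \<open>w\<close> the
      gain \<open>inner z w\<close> cannot beat the growth at any \<open>z\<close> with
      \<open>norm z \<ge> s\<close>.\<close>
    proof (intro exI[of _ "(m/4) * s"] conjI allI impI)
      show "0 < m / 4 * s" using m s by simp
      fix w :: 'a assume w: "norm w < m / 4 * s"
      show "legendre \<psi> (g + w) \<le> ereal (c + inner x w + (1/2) * inner (B w) w + e * (norm w)\<^sup>2)"
      proof (rule legendre_le[OF cv])
        fix y assume y: "\<psi> y < \<infinity>"
        define z where "z = y - x"
        have yz: "y = x + z" by (simp add: z_def)
        have *: "inner z w - (f (x + z) - f x - inner g z) \<le> (1/2) * inner (B w) w + e * (norm w)\<^sup>2"
        \<comment> \<open>If the gain does not exceed the growth, the left-hand side is at most 0.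
          Otherwise \<open>z\<close> must lie within \<open>s\<close> and within
          \<open>(4/m) * norm w\<close>, where the expansion and \<open>quad\<close> apply.\<close>
        proof (cases "inner z w \<le> f (x + z) - f x - inner g z")
          case True
          have "0 \<le> e * (norm w)\<^sup>2" using e by simp
          then show ?thesis using True Bpsd[of w] by linarith
        next
          case False
          have zw: "inner z w \<le> norm z * norm w" by (rule norm_cauchy_schwarz)
          have nzs: "norm z < s"
          proof (rule ccontr)
            assume "\<not> norm z < s"
            then have "f x + inner g z + (m/4) * s * norm z \<le> f (x + z)"
              using far[of z] y yz by simp
            moreover have "norm z * norm w \<le> norm z * ((m/4) * s)"
              using w by (intro mult_left_mono) auto
            ultimately show False using False zw by (simp add: mult.commute)
          qed
          then have nzd: "norm z < d" using s by simp
          have "(m/4) * (norm z)\<^sup>2 \<le> norm z * norm w"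
            using near'[OF nzd] False zw by linarith
          then have "norm z * ((m/4) * norm z) \<le> norm z * norm w"
            by (simp add: power2_eq_square algebra_simps)
          moreover have "norm z > 0"
          proof (rule ccontr)
            assume "\<not> norm z > 0"
            then have "z = 0" by simp
            with False show False by simp
          qed
          ultimately have "(m/4) * norm z \<le> norm w" by simp
          then have "norm z \<le> (4/m) * norm w" using m by (simp add: field_simps)
          then have "(norm z)\<^sup>2 \<le> ((4/m) * norm w)\<^sup>2" by (intro power_mono) auto
          then have "e1 * (norm z)\<^sup>2 \<le> (e * m\<^sup>2 / 16) * ((4/m) * norm w)\<^sup>2"
            using e1 by (intro mult_mono) auto
          also have "\<dots> = e * (norm w)\<^sup>2" using m by (simp add: power2_eq_square field_simps)
          finally show ?thesis using near[OF nzd] quad[of z w] by linarith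
        qed
        have fy: "real_of_ereal (\<psi> y) = f (x + z)" by (simp add: f_def yz)
        show "inner y (g + w) - real_of_ereal (\<psi> y) \<le> c + inner x w + (1/2) * inner (B w) w + e * (norm w)\<^sup>2"
          unfolding fy using * unfolding yz c_def by (simp add: inner_add_left inner_add_right inner_commute)
      qed
    qed
  qed
  have lower: "\<exists>d>0. \<forall>w. norm w < d \<longrightarrow>
      ereal (c + inner x w + (1/2) * inner (B w) w - e * (norm w)\<^sup>2) \<le> legendre \<psi> (g + w)"
    if e: "e > 0" for e
  proof -
    \<comment> \<open>The competitor in the supremum is \<open>x + B w\<close>, optimal for the
      quadratic model. Since \<open>norm (B w) \<le> L * norm w\<close>, the divisor
      \<open>L\<^sup>2\<close> turns its error into \<open>e * (norm w)\<^sup>2\<close>.\<close>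
    define e2 where "e2 = e / L\<^sup>2"
    have e2: "e2 > 0" using e L by (simp add: e2_def)
    obtain d where d: "d > 0" "\<And>y. norm (y - x) < d \<Longrightarrow>
       \<bar>f y - f x - inner g (y - x) - (1/2) * inner (A (y - x)) (y - x)\<bar> \<le> e2 * (norm (y - x))\<^sup>2"
      using so e2 unfolding second_order_def by blast
    show ?thesis
    proof (intro exI[of _ "min d r / L"] conjI allI impI)
      show "0 < min d r / L" using d r L by simp
      fix w :: 'a assume w: "norm w < min d r / L"
      have "norm (B w) \<le> L * norm w" by (rule L)
      also have "\<dots> < min d r" using w L(1) by (simp add: pos_less_divide_eq mult.commute)
      finally have Bw: "norm (B w) < d" "norm (B w) < r" by auto
      have "f (x + B w) - f x - inner g (B w) - (1/2) * inner w (B w) \<le> e2 * (norm (B w))\<^sup>2"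
        using d(2)[of "x + B w"] Bw by (simp add: B abs_le_iff)
      also have "\<dots> \<le> e2 * (L * norm w)\<^sup>2"
        using L e2 by (intro mult_left_mono power_mono) auto
      also have "\<dots> = e * (norm w)\<^sup>2" using L by (simp add: e2_def power_mult_distrib)
      finally have "c + inner x w + (1/2) * inner (B w) w - e * (norm w)\<^sup>2
          \<le> inner (x + B w) (g + w) - f (x + B w)"
        unfolding c_def by (simp add: inner_add_left inner_add_right inner_commute)
      then have "ereal (c + inner x w + (1/2) * inner (B w) w - e * (norm w)\<^sup>2)
          \<le> ereal (inner (x + B w) (g + w) - f (x + B w))" by simp
      also have "\<dots> \<le> legendre \<psi> (g + w)"
        unfolding f_def using Bw by (intro fenchel_le[OF cv dom]) simp
      finally show "ereal (c + inner x w + (1/2) * inner (B w) w - e * (norm w)\<^sup>2) \<le> legendre \<psi> (g + w)" .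
    qed
  qed
  define fs where "fs = (\<lambda>y. real_of_ereal (legendre \<psi> y))"
  have fsg: "fs g = c" using legendre_grad[OF cv x] by (simp add: fs_def g_def c_def f_def)
  \<comment> \<open>Any one instance of the upper bound makes the conjugate finite on a ball around
    \<open>g\<close>.\<close>
  have int: "g \<in> interior {y. legendre \<psi> y < \<infinity>}"
  proof -
    obtain d where d: "d > 0" "\<And>w. norm w < d \<Longrightarrow>
      legendre \<psi> (g + w) \<le> ereal (c + inner x w + (1/2) * inner (B w) w + 1 * (norm w)\<^sup>2)"
      using upper[OF zero_less_one] by blast
    have "legendre \<psi> y < \<infinity>" if "y \<in> ball g d" for y
      using d(2)[of "y - g"] that by (auto simp: dist_norm norm_minus_commute)
    then show ?thesis using d(1) by (metis (mono_tags, lifting) mem_Collect_eq mem_interior subsetI)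
  qed
  have sos: "second_order fs g x B" unfolding second_order_def
  proof (intro allI impI)
    fix e :: real assume e: "e > 0"
    obtain d1 where d1: "d1 > 0" "\<And>w. norm w < d1 \<Longrightarrow>
      legendre \<psi> (g + w) \<le> ereal (c + inner x w + (1/2) * inner (B w) w + e * (norm w)\<^sup>2)"
      using upper[OF e] by blast
    obtain d2 where d2: "d2 > 0" "\<And>w. norm w < d2 \<Longrightarrow>
      ereal (c + inner x w + (1/2) * inner (B w) w - e * (norm w)\<^sup>2) \<le> legendre \<psi> (g + w)"
      using lower[OF e] by blast
    show "\<exists>d>0. \<forall>y. norm (y - g) < d \<longrightarrow>
       \<bar>fs y - fs g - inner x (y - g) - (1/2) * inner (B (y - g)) (y - g)\<bar> \<le> e * (norm (y - g))\<^sup>2"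
    proof (intro exI[of _ "min d1 d2"] conjI allI impI)
      show "0 < min d1 d2" using d1 d2 by simp
      fix y assume "norm (y - g) < min d1 d2"
      then show "\<bar>fs y - fs g - inner x (y - g) - (1/2) * inner (B (y - g)) (y - g)\<bar> \<le> e * (norm (y - g))\<^sup>2"
        using d1(2)[of "y - g"] d2(2)[of "y - g"] unfolding fsg
        unfolding fs_def by (cases "legendre \<psi> y") (auto simp: abs_le_iff)
    qed
  qed
  show "grad \<psi> x \<in> Xset (legendre \<psi>)" "grad (legendre \<psi>) (grad \<psi> x) = x"
    using XsetI[OF B(1) Bsym Binj int, of x] sos unfolding fs_def g_def by auto
qed

section \<open>Measurability\<close>

lemma econvex_continuous_on_interior:
  assumes "econvex \<psi>"
  shows "continuous_on (interior {y. \<psi> y < \<infinity>}) (\<lambda>y. real_of_ereal (\<psi> y))"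
proof (rule convex_on_continuous[OF open_interior])
  have "convex_on {y. \<psi> y < \<infinity>} (\<lambda>y. real_of_ereal (\<psi> y))" using assms by (simp add: econvex_def)
  then show "convex_on (interior {y. \<psi> y < \<infinity>}) (\<lambda>y. real_of_ereal (\<psi> y))"
    using convex_on_subset[OF _ interior_subset] convex_interior convex_on_imp_convex by blast
qed

section \<open>The set of second-order points is Borel\<close>

definition hessian_candidates :: "nat \<Rightarrow> ('a::euclidean_space \<times> ('a \<Rightarrow>\<^sub>L 'a)) set" where
  "hessian_candidates N = {(g, A). norm g \<le> real N \<and> norm A \<le> real N
     \<and> (\<forall>u v. inner (blinfun_apply A u) v = inner u (blinfun_apply A v))
     \<and> (\<forall>v. norm v \<le> real N * norm (blinfun_apply A v))}"

text \<open>One fixed error, one fixed radius and data from one compact set: with these constants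
  frozen, the set is closed relative to \<open>U\<close> wherever \<open>f\<close> is
  continuous.\<close>

definition approx_second_order ::
    "'a::euclidean_space set \<Rightarrow> ('a \<Rightarrow> real) \<Rightarrow> nat \<Rightarrow> real \<Rightarrow> real \<Rightarrow> 'a set" where
  "approx_second_order U f N e d = {x\<in>U. \<exists>(g, A)\<in>hessian_candidates N. \<forall>y\<in>U. norm (y - x) < d \<longrightarrow>
     \<bar>f y - f x - inner g (y - x) - (1/2) * inner (blinfun_apply A (y - x)) (y - x)\<bar> \<le> e * (norm (y - x))\<^sup>2}"

text \<open>Injectivity is not a closed condition, so it is encoded by the lower bound
  \<open>norm v \<le> real N * norm (A v)\<close>, which survives limits; the rest is boundedness in
  finite dimension.\<close>

lemma compact_hessian_candidates:
  "compact (hessian_candidates N :: ('a::euclidean_space \<times> ('a \<Rightarrow>\<^sub>L 'a)) set)"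
proof -
  have eq: "hessian_candidates N = (cball 0 (real N) \<times> cball 0 (real N)) \<inter>
     {p :: 'a \<times> ('a \<Rightarrow>\<^sub>L 'a). (\<forall>u v. inner (blinfun_apply (snd p) u) v = inner u (blinfun_apply (snd p) v)) \<and> (\<forall>v. norm v \<le> real N * norm (blinfun_apply (snd p) v))}"
    unfolding hessian_candidates_def by auto
  have "closed {p :: 'a \<times> ('a \<Rightarrow>\<^sub>L 'a). (\<forall>u v. inner (blinfun_apply (snd p) u) v = inner u (blinfun_apply (snd p) v)) \<and> (\<forall>v. norm v \<le> real N * norm (blinfun_apply (snd p) v))}"
    by (intro closed_Collect_conj closed_Collect_all closed_Collect_eq closed_Collect_le continuous_intros)
  then show ?thesis unfolding eq by (intro compact_Int_closed compact_Times compact_cball)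
qed

text \<open>Along a sequence converging inside \<open>U\<close>, compactness gives a convergent
  subsequence of gradients and Hessians. For fixed \<open>y\<close> the strict condition on the
  radius eventually holds along it, so the estimate passes to the limit.\<close>

lemma approx_second_order_eq_closure:
  fixes f :: "'a::euclidean_space \<Rightarrow> real"
  assumes cf: "continuous_on U f"
  shows "approx_second_order U f N e d = U \<inter> closure (approx_second_order U f N e d)"
proof (intro set_eqI iffI)
  show "l \<in> U \<inter> closure (approx_second_order U f N e d)" if "l \<in> approx_second_order U f N e d" for l
    using that closure_subset[of "approx_second_order U f N e d"] by (auto simp: approx_second_order_def)
next
  fix l assume "l \<in> U \<inter> closure (approx_second_order U f N e d)"
  then obtain x where x: "\<And>n. x n \<in> approx_second_order U f N e d" and l: "l \<in> U" and lim: "x \<longlonglongrightarrow> l"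
    by (auto simp: closure_sequential)
  have "\<forall>n. \<exists>p. p \<in> hessian_candidates N \<and> (\<forall>y\<in>U. norm (y - x n) < d \<longrightarrow>
     \<bar>f y - f (x n) - inner (fst p) (y - x n) - (1/2) * inner (blinfun_apply (snd p) (y - x n)) (y - x n)\<bar> \<le> e * (norm (y - x n))\<^sup>2)"
    using x unfolding approx_second_order_def by fastforce
  then obtain p where p: "\<And>n. p n \<in> hessian_candidates N"
    "\<And>n y. y \<in> U \<Longrightarrow> norm (y - x n) < d \<Longrightarrow>
     \<bar>f y - f (x n) - inner (fst (p n)) (y - x n) - (1/2) * inner (blinfun_apply (snd (p n)) (y - x n)) (y - x n)\<bar> \<le> e * (norm (y - x n))\<^sup>2"
    by metis
  obtain q r where q: "q \<in> hessian_candidates N" and r: "strict_mono r" "(p \<circ> r) \<longlonglongrightarrow> q"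
    using compact_hessian_candidates p(1) by (metis compact_def)
  have pl: "(\<lambda>n. p (r n)) \<longlonglongrightarrow> q" using r(2) by (simp add: o_def)
  have xl: "(\<lambda>n. x (r n)) \<longlonglongrightarrow> l" using LIMSEQ_subseq_LIMSEQ[OF lim r(1)] by (simp add: o_def)
  have xU: "x n \<in> U" for n using x[of n] unfolding approx_second_order_def by blast
  have fl: "(\<lambda>n. f (x (r n))) \<longlonglongrightarrow> f l"
    using continuous_on_tendsto_compose[OF cf xl l] xU by auto
  have "\<bar>f y - f l - inner (fst q) (y - l) - (1/2) * inner (blinfun_apply (snd q) (y - l)) (y - l)\<bar> \<le> e * (norm (y - l))\<^sup>2"
    if y: "y \<in> U" "norm (y - l) < d" for y
  proof (rule tendsto_le[OF sequentially_bot])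
    show "(\<lambda>n. e * (norm (y - x (r n)))\<^sup>2) \<longlonglongrightarrow> e * (norm (y - l))\<^sup>2"
      by (intro tendsto_intros xl)
    show "(\<lambda>n. \<bar>f y - f (x (r n)) - inner (fst (p (r n))) (y - x (r n)) - (1/2) * inner (blinfun_apply (snd (p (r n))) (y - x (r n))) (y - x (r n))\<bar>)
       \<longlonglongrightarrow> \<bar>f y - f l - inner (fst q) (y - l) - (1/2) * inner (blinfun_apply (snd q) (y - l)) (y - l)\<bar>"
      by (intro tendsto_intros xl pl fl)
    have "(\<lambda>n. norm (y - x (r n))) \<longlonglongrightarrow> norm (y - l)" by (intro tendsto_intros xl)
    then have "\<forall>\<^sub>F n in sequentially. norm (y - x (r n)) < d" using y(2) by (rule order_tendstoD)
    then show "\<forall>\<^sub>F n in sequentially. \<bar>f y - f (x (r n)) - inner (fst (p (r n))) (y - x (r n)) - (1/2) * inner (blinfun_apply (snd (p (r n))) (y - x (r n))) (y - x (r n))\<bar>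
        \<le> e * (norm (y - x (r n)))\<^sup>2"
      by eventually_elim (rule p(2)[OF y(1)])
  qed
  then show "l \<in> approx_second_order U f N e d"
    unfolding approx_second_order_def using l q by (auto intro!: bexI[of _ q] simp: case_prod_beta)
qed

text \<open>The approximate gradients at all scales coincide, so only the approximate Hessians need a limit.\<close>

lemma Xset_eq_approx:
  fixes \<psi> :: "'a::euclidean_space \<Rightarrow> ereal"
  defines "U \<equiv> interior {y. \<psi> y < \<infinity>}" and "f \<equiv> (\<lambda>y. real_of_ereal (\<psi> y))"
  shows "Xset \<psi> = (\<Union>N. \<Inter>k. \<Union>j. approx_second_order U f N (inverse (real (Suc k))) (inverse (real (Suc j))))"
    (is "_ = ?R")
proof (intro set_eqI iffI)
  fix x assume "x \<in> Xset \<psi>"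
  then obtain A where A: "linear A" "\<And>u v. inner (A u) v = inner u (A v)" "inj A"
    and x: "x \<in> U" and so: "second_order f x (grad \<psi> x) A"
    unfolding U_def f_def by (metis XsetE)
  define L where "L = Blinfun A"
  have L: "blinfun_apply L = A"
    unfolding L_def using A(1) by (simp add: bounded_linear_Blinfun_apply linear_conv_bounded_linear)
  obtain b where b: "b > 0" "\<And>v. b * norm v \<le> norm (A v)"
    using linear_inj_bounded_below_pos[OF A(1,3)] by (metis mult.commute)
  \<comment> \<open>One \<open>N\<close> dominates the gradient, the Hessian and the bound
    \<open>inverse b\<close> for its inverse.\<close>
  obtain N where N: "norm (grad \<psi> x) + norm L + inverse b \<le> real N" by (meson real_arch_simple)
  have "norm v \<le> real N * norm (A v)" for v
  proof -
    have "norm v \<le> inverse b * norm (A v)" using b(2)[of v] b(1) by (simp add: field_simps)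
    also have "\<dots> \<le> real N * norm (A v)"
      using N norm_ge_zero[of L] norm_ge_zero[of "grad \<psi> x"]
      by (intro mult_right_mono[OF _ norm_ge_zero]) linarith
    finally show ?thesis .
  qed
  moreover have "norm (grad \<psi> x) \<le> real N" "norm L \<le> real N"
    using N b(1) norm_ge_zero[of L] norm_ge_zero[of "grad \<psi> x"] positive_imp_inverse_positive[OF b(1)] by linarith+
  ultimately have mem: "(grad \<psi> x, L) \<in> hessian_candidates N"
    unfolding hessian_candidates_def using A by (simp add: L)
  have "\<exists>j. x \<in> approx_second_order U f N (inverse (real (Suc k))) (inverse (real (Suc j)))" for k
  proof -
    have "0 < inverse (real (Suc k))" by simp
    then obtain d where d: "d > 0" "\<And>y. norm (y - x) < d \<Longrightarrow>
       \<bar>f y - f x - inner (grad \<psi> x) (y - x) - (1/2) * inner (A (y - x)) (y - x)\<bar> \<le> inverse (real (Suc k)) * (norm (y - x))\<^sup>2"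
      using so unfolding second_order_def by blast
    obtain j where j: "inverse (real (Suc j)) < d" using reals_Archimedean[OF d(1)] by blast
    show ?thesis unfolding approx_second_order_def
      using x mem d(2) j L by (intro exI[of _ j]) (auto intro!: bexI[of _ "(grad \<psi> x, L)"])
  qed
  then show "x \<in> ?R" by (subst UN_iff, intro bexI[of _ N] INT_I UNIV_I) (simp only: UN_iff bex_UNIV)
next
  fix x assume "x \<in> ?R"
  then have "\<exists>N. \<forall>k. \<exists>j. x \<in> approx_second_order U f N (inverse (real (Suc k))) (inverse (real (Suc j)))"
    by (simp only: UN_iff INT_iff bex_UNIV ball_UNIV)
  then obtain N where "\<forall>k. \<exists>j. x \<in> approx_second_order U f N (inverse (real (Suc k))) (inverse (real (Suc j)))" ..
  then have N: "\<exists>j. x \<in> approx_second_order U f N (inverse (real (Suc k))) (inverse (real (Suc j)))" for k ..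
  then have x: "x \<in> U" unfolding approx_second_order_def by blast
  \<comment> \<open>A ball inside \<open>U\<close> turns estimates over \<open>y \<in> U\<close>
    into estimates on a full neighbourhood.\<close>
  obtain \<rho> where \<rho>: "\<rho> > 0" "ball x \<rho> \<subseteq> U" using x unfolding U_def by (meson open_interior openE)
  have "\<exists>p d. p \<in> hessian_candidates N \<and> d > 0 \<and> (\<forall>y. norm (y - x) < d \<longrightarrow>
       \<bar>f y - f x - inner (fst p) (y - x) - (1/2) * inner (blinfun_apply (snd p) (y - x)) (y - x)\<bar> \<le> inverse (real (Suc k)) * (norm (y - x))\<^sup>2)" for k
  proof -
    obtain j p where p: "p \<in> hessian_candidates N" "\<And>y. y \<in> U \<Longrightarrow> norm (y - x) < inverse (real (Suc j)) \<Longrightarrow>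
       \<bar>f y - f x - inner (fst p) (y - x) - (1/2) * inner (blinfun_apply (snd p) (y - x)) (y - x)\<bar> \<le> inverse (real (Suc k)) * (norm (y - x))\<^sup>2"
      using N[of k] unfolding approx_second_order_def by fastforce
    have "y \<in> U" if "norm (y - x) < \<rho>" for y
      using \<rho>(2) that by (auto simp: dist_norm norm_minus_commute subset_iff)
    then show ?thesis using p \<rho>(1)
      by (intro exI[of _ p] exI[of _ "min \<rho> (inverse (real (Suc j)))"]) auto
  qed
  then obtain p d where p: "\<And>k. p k \<in> hessian_candidates N" and d: "\<And>k. d k > 0"
    and bound: "\<And>k y. norm (y - x) < d k \<Longrightarrow>
       \<bar>f y - f x - inner (fst (p k)) (y - x) - (1/2) * inner (blinfun_apply (snd (p k)) (y - x)) (y - x)\<bar> \<le> inverse (real (Suc k)) * (norm (y - x))\<^sup>2"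
    by metis
  have deriv: "(f has_derivative (\<lambda>v. inner (fst (p k)) v)) (at x)" for k
  proof -
    obtain K where K: "K > 0" "\<And>v. \<bar>inner (blinfun_apply (snd (p k)) v) v\<bar> \<le> K * (norm v)\<^sup>2"
      using inner_linear_le[of "blinfun_apply (snd (p k))"] bounded_linear.linear[OF blinfun.bounded_linear_right] by metis
    show ?thesis
    proof (rule quadratic_bound_has_derivative)
      show "0 < inverse (real (Suc k)) + K" using K by (simp add: add_pos_pos)
      show "0 < d k" by (rule d)
      show "\<bar>f y - f x - inner (fst (p k)) (y - x)\<bar> \<le> (inverse (real (Suc k)) + K) * (norm (y - x))\<^sup>2"
        if "norm (y - x) < d k" for y
        using bound[OF that] K(2)[of "y - x"] by (simp add: distrib_right abs_le_iff del: of_nat_Suc)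
    qed
  qed
  define g where "g = fst (p 0)"
  have gk: "fst (p k) = g" for k unfolding g_def by (rule inner_has_derivative_unique[OF deriv deriv])
  obtain q r where q: "q \<in> hessian_candidates N" and r: "strict_mono r" "(p \<circ> r) \<longlonglongrightarrow> q"
    using compact_hessian_candidates p by (metis compact_def)
  define A where "A = snd q"
  have Al: "(\<lambda>n. snd (p (r n))) \<longlonglongrightarrow> A"
    using tendsto_snd[OF r(2)] by (simp add: o_def A_def)
  have A: "linear (blinfun_apply A)" "\<And>u v. inner (A u) v = inner u (A v)" "\<And>v. norm v \<le> real N * norm (A v)"
    using q unfolding hessian_candidates_def A_def by (auto intro: bounded_linear.linear[OF blinfun.bounded_linear_right])
  have inj: "inj (blinfun_apply A)"
    unfolding linear_injective_0[OF A(1)] using A(3) by (metis mult_zero_right norm_le_zero_iff norm_zero)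
  have "second_order f x g A" unfolding second_order_def
  proof (intro allI impI)
    fix e :: real assume e: "e > 0"
    \<comment> \<open>The Hessian error enters with factor 1/2, so tolerance \<open>e\<close> for it
      and \<open>e / 2\<close> for the expansion add up to \<open>e\<close>.\<close>
    have "\<forall>\<^sub>F n in sequentially. dist (snd (p (r n))) A < e" using Al e by (rule tendstoD)
    moreover have "\<forall>\<^sub>F n in sequentially. inverse (real (Suc n)) < e / 2"
      using LIMSEQ_inverse_real_of_nat e by (intro order_tendstoD) auto
    ultimately have "\<forall>\<^sub>F n in sequentially. dist (snd (p (r n))) A < e \<and> inverse (real (Suc n)) < e / 2"
      by (rule eventually_conj)
    then have "\<exists>n. dist (snd (p (r n))) A < e \<and> inverse (real (Suc n)) < e / 2"
      by (rule eventually_happens'[OF sequentially_bot])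
    then obtain n where n: "dist (snd (p (r n))) A < e" "inverse (real (Suc n)) < e / 2"
      by auto
    have "inverse (real (Suc (r n))) \<le> inverse (real (Suc n))"
      using seq_suble[OF r(1), of n] by (intro le_imp_inverse_le) auto
    then have n': "inverse (real (Suc (r n))) \<le> e / 2" using n by linarith
    have "\<bar>f y - f x - inner g (y - x) - (1/2) * inner (A (y - x)) (y - x)\<bar> \<le> e * (norm (y - x))\<^sup>2"
      if y: "norm (y - x) < d (r n)" for y
    proof -
      let ?v = "y - x" and ?D = "snd (p (r n)) - A"
      have "\<bar>f y - f x - inner g ?v - (1/2) * inner (blinfun_apply (snd (p (r n))) ?v) ?v\<bar> \<le> inverse (real (Suc (r n))) * (norm ?v)\<^sup>2"
        using bound[OF y] by (simp add: gk del: of_nat_Suc)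
      also have "\<dots> \<le> (e / 2) * (norm ?v)\<^sup>2" using n' by (intro mult_right_mono) auto
      finally have 1: "\<bar>f y - f x - inner g ?v - (1/2) * inner (blinfun_apply (snd (p (r n))) ?v) ?v\<bar> \<le> (e / 2) * (norm ?v)\<^sup>2" .
      have "\<bar>inner (?D ?v) ?v\<bar> \<le> norm (?D ?v) * norm ?v" by (rule Cauchy_Schwarz_ineq2)
      also have "\<dots> \<le> (norm ?D * norm ?v) * norm ?v" by (intro mult_right_mono norm_blinfun) auto
      also have "\<dots> \<le> (e * norm ?v) * norm ?v"
        using n(1) by (intro mult_right_mono) (auto simp: dist_norm)
      finally have "\<bar>inner (?D ?v) ?v\<bar> \<le> e * (norm ?v)\<^sup>2" by (simp add: power2_eq_square mult.assoc)
      moreover have "inner (?D ?v) ?v = inner (blinfun_apply (snd (p (r n))) ?v) ?v - inner (A ?v) ?v"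
        by (simp add: blinfun.diff_left inner_diff_left)
      ultimately show ?thesis using 1 unfolding abs_le_iff by linarith
    qed
    then show "\<exists>d>0. \<forall>y. norm (y - x) < d \<longrightarrow>
       \<bar>f y - f x - inner g (y - x) - (1/2) * inner (A (y - x)) (y - x)\<bar> \<le> e * (norm (y - x))\<^sup>2"
      using d by blast
  qed
  then show "x \<in> Xset \<psi>"
    using XsetI(1)[OF A(1,2) inj] x unfolding U_def f_def by blast
qed

lemma Xset_borel:
  assumes "econvex \<psi>"
  shows "Xset \<psi> \<in> sets borel"
proof -
  have "approx_second_order (interior {y. \<psi> y < \<infinity>}) (\<lambda>y. real_of_ereal (\<psi> y)) N e d \<in> sets borel" for N e d
    by (subst approx_second_order_eq_closure[OF econvex_continuous_on_interior[OF assms]])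
      (intro sets.Int borel_open borel_closed open_interior closed_closure)
  then show ?thesis by (subst Xset_eq_approx) (intro sets.countable_UN sets.countable_INT subsetI, auto)
qed

lemma Xset_lebesgue: "econvex \<psi> \<Longrightarrow> Xset \<psi> \<in> sets lebesgue"
  using Xset_borel[of \<psi>] by (metis sets_completionI_sets sets_lborel)

lemma continuous_on_Xset_measurable:
  fixes f :: "'a::euclidean_space \<Rightarrow> 'b::euclidean_space"
  assumes cv: "econvex \<psi>" and f: "continuous_on (Xset \<psi>) f"
  shows "f \<in> borel_measurable (restrict_space lebesgue (Xset \<psi>))"
proof -
  have "(\<lambda>x. indicator (Xset \<psi>) x *\<^sub>R f x) \<in> borel_measurable borel"
    by (rule borel_measurable_continuous_on_indicator[OF Xset_borel[OF cv] f])
  then have "(\<lambda>x. indicator (Xset \<psi>) x *\<^sub>R f x) \<in> borel_measurable lebesgue"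
    by (intro measurable_completion) simp
  then show ?thesis
    using Xset_lebesgue[OF cv] by (subst borel_measurable_restrict_space_iff) auto
qed

lemma Xset_subset_interior: "Xset \<psi> \<subseteq> interior {y. \<psi> y < \<infinity>}"
  by (auto simp: Xset_def alex_hessian_def)

lemma real_of_ereal_Xset_measurable:
  assumes "econvex \<psi>"
  shows "(\<lambda>x. real_of_ereal (\<psi> x)) \<in> borel_measurable (restrict_space lebesgue (Xset \<psi>))"
  by (intro continuous_on_Xset_measurable assms
      continuous_on_subset[OF econvex_continuous_on_interior[OF assms] Xset_subset_interior])

text \<open>A Lebesgue measurable \<open>g\<close> is Borel off a null set, and the preimage of a null set under the gradient
  is its image under the gradient of the conjugate, hence null.\<close>

lemma measurable_compose_grad:
  fixes \<psi> :: "'a::euclidean_space \<Rightarrow> ereal"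
  assumes cv: "econvex \<psi>" and cv': "econvex (legendre \<psi>)"
    and g: "set_borel_measurable lebesgue (Xset (legendre \<psi>)) g"
  shows "(\<lambda>x. g (grad \<psi> x) :: real) \<in> borel_measurable (restrict_space lebesgue (Xset \<psi>))"
proof -
  define X where "X = Xset \<psi>"
  define Y where "Y = Xset (legendre \<psi>)"
  obtain k where k: "k \<in> borel_measurable lborel" "AE y in lborel. indicator Y y *\<^sub>R g y = k y"
    using completion_ex_borel_measurable_real[of "\<lambda>y. indicator Y y *\<^sub>R g y" lborel] g
    unfolding set_borel_measurable_def Y_def by blast
  obtain N where N: "\<And>y. y \<notin> N \<Longrightarrow> indicator Y y *\<^sub>R g y = k y" "N \<in> null_sets lborel"
    using AE_E3[OF k(2)] by auto
  have "negligible (N \<inter> Y)"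
    using N(2) by (meson negligible_iff_null_sets negligible_Int null_sets_completionI)
  then have neg: "negligible (grad (legendre \<psi>) ` (N \<inter> Y))"
    by (intro negligible_grad_image[OF cv']) (auto simp: Y_def)
  define G where "G = (\<lambda>x. indicator X x *\<^sub>R grad \<psi> x)"
  have G: "G \<in> borel_measurable borel"
    unfolding G_def X_def
    by (rule borel_measurable_continuous_on_indicator[OF Xset_borel[OF cv] continuous_on_grad[OF cv]])
  have "(\<lambda>x. indicator X x *\<^sub>R k (G x)) \<in> borel_measurable borel"
    using k(1) G Xset_borel[OF cv] unfolding X_def[symmetric] by simp
  then have m: "(\<lambda>x. indicator X x *\<^sub>R k (G x)) \<in> borel_measurable lebesgue"
    by (intro measurable_completion) simp
  have "indicator X x *\<^sub>R k (G x) = indicator X x *\<^sub>R g (grad \<psi> x)"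
    if "x \<notin> grad (legendre \<psi>) ` (N \<inter> Y)" for x
  proof (cases "x \<in> X")
    case True
    then have Y: "grad \<psi> x \<in> Y" "grad (legendre \<psi>) (grad \<psi> x) = x"
      using Xset_legendre[OF cv] by (auto simp: X_def Y_def)
    then have "grad \<psi> x \<notin> N" using that by (metis IntI image_eqI)
    then show ?thesis using N(1)[of "grad \<psi> x"] Y True by (simp add: G_def)
  qed simp
  then have "AE x in lebesgue. indicator X x *\<^sub>R k (G x) = indicator X x *\<^sub>R g (grad \<psi> x)"
    using neg unfolding negligible_iff_null_sets by (intro AE_I'[of "grad (legendre \<psi>) ` (N \<inter> Y)"]) auto
  then have "(\<lambda>x. indicator X x *\<^sub>R g (grad \<psi> x)) \<in> borel_measurable lebesgue"
    by (rule borel_measurable_AE[OF m])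
  then show ?thesis
    using Xset_lebesgue[OF cv] unfolding X_def by (subst borel_measurable_restrict_space_iff) auto
qed

lemma F2_legendre_Fplus:
  assumes cv': "econvex (legendre \<psi>)"
    and F2: "F2 \<in> borel_measurable borel" "\<forall>t. 0 < F2 t"
    and I: "0 < Iint (\<lambda>y. F2 (real_of_ereal (legendre \<psi> y))) (legendre \<psi>)"
      "Iint (\<lambda>y. F2 (real_of_ereal (legendre \<psi> y))) (legendre \<psi>) < \<infinity>"
  shows "(\<lambda>y. F2 (real_of_ereal (legendre \<psi> y))) \<in> Fplus (legendre \<psi>)"
proof -
  have "(\<lambda>y. F2 (real_of_ereal (legendre \<psi> y))) \<in> borel_measurable (restrict_space lebesgue (Xset (legendre \<psi>)))"
    by (rule measurable_compose[OF real_of_ereal_Xset_measurable[OF cv'] F2(1)])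
  then have "set_borel_measurable lebesgue (Xset (legendre \<psi>)) (\<lambda>y. F2 (real_of_ereal (legendre \<psi> y)))"
    unfolding set_borel_measurable_def
    using Xset_lebesgue[OF cv'] by (subst (asm) borel_measurable_restrict_space_iff) auto
  then show ?thesis unfolding Fplus_def using F2 I by auto
qed

section \<open>Integrals of functions of the Orlicz ratio\<close>

definition orlicz_ratio :: "(real \<Rightarrow> real) \<Rightarrow> ('a::euclidean_space \<Rightarrow> ereal) \<Rightarrow> ('a \<Rightarrow> real) \<Rightarrow> 'a \<Rightarrow> real" where
  "orlicz_ratio F2 \<psi> g x = g (grad \<psi> x) / F2 (inner x (grad \<psi> x) - real_of_ereal (\<psi> x))"

lemma normalize_pos:
  assumes "g \<in> Fplus \<phi>" "y \<in> Xset \<phi>"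
  shows "0 < normalize g \<phi> y"
  using assms unfolding normalize_def Fplus_def by (auto simp: enn2real_positive_iff)

text \<open>\<open>g\<close> is known to be positive only on \<open>Xset (legendre \<psi>)\<close>,
  which is where the gradient takes its values.\<close>

lemma orlicz_ratio_pos:
  assumes "econvex \<psi>" "g \<in> Fplus (legendre \<psi>)" "\<forall>t. 0 < F2 t" "x \<in> Xset \<psi>"
  shows "0 < orlicz_ratio F2 \<psi> (normalize g (legendre \<psi>)) x"
  unfolding orlicz_ratio_def using assms normalize_pos[OF assms(2) Xset_legendre(1)[OF assms(1,4)]] by simp

lemma orlicz_ratio_measurable:
  assumes cv: "econvex \<psi>" and cv': "econvex (legendre \<psi>)"
    and g: "g \<in> Fplus (legendre \<psi>)" and F2: "F2 \<in> borel_measurable borel"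
  shows "orlicz_ratio F2 \<psi> (normalize g (legendre \<psi>)) \<in> borel_measurable (restrict_space lebesgue (Xset \<psi>))"
proof -
  let ?R = "restrict_space lebesgue (Xset \<psi>)"
  have [measurable]: "(\<lambda>x. g (grad \<psi> x)) \<in> borel_measurable ?R"
    using g by (intro measurable_compose_grad[OF cv cv']) (simp add: Fplus_def)
  have [measurable]: "(\<lambda>x. inner x (grad \<psi> x)) \<in> borel_measurable ?R"
    by (intro continuous_on_Xset_measurable[OF cv] continuous_intros continuous_on_grad[OF cv])
  note [measurable] = real_of_ereal_Xset_measurable[OF cv] F2
  show ?thesis unfolding orlicz_ratio_def normalize_def by measurable
qed

lemma Vfun_eq_restrict:
  assumes "econvex \<psi>"
  shows "Vfun h F1 F2 \<psi> g = (\<integral>\<^sup>+ x. ennreal (h (orlicz_ratio F2 \<psi> g x) * F1 (real_of_ereal (\<psi> x))) \<partial>restrict_space lebesgue (Xset \<psi>))"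
  unfolding Vfun_def orlicz_ratio_def
  using Xset_lebesgue[OF assms] by (subst nn_integral_restrict_space) (auto simp: mult.commute)

lemma Iint_eq_restrict:
  assumes "econvex \<psi>"
  shows "Iint f \<psi> = (\<integral>\<^sup>+ x. ennreal (f x) \<partial>restrict_space lebesgue (Xset \<psi>))"
  unfolding Iint_def
  using Xset_lebesgue[OF assms] by (subst nn_integral_restrict_space) (auto simp: mult.commute)

text \<open>All later comparisons of areas integrate a pointwise inequality through this lemma.
  Coefficients are nonnegative on both sides, so the integral splits additively in
  \<open>ennreal\<close> even if \<open>V h\<close> or \<open>V h1\<close> is infinite, and
  constants become multiples of \<open>I1\<close>.\<close>

lemma Vfun_affine_mono:
  fixes \<psi> :: "'a::euclidean_space \<Rightarrow> ereal"
  assumes cv: "econvex \<psi>" and cv': "econvex (legendre \<psi>)"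
    and g: "g \<in> Fplus (legendre \<psi>)"
    and F1: "F1 \<in> borel_measurable borel" "\<forall>t. 0 < F1 t"
    and F2: "F2 \<in> borel_measurable borel" "\<forall>t. 0 < F2 t"
    and h: "admissible h" "admissible h1"
    and nn: "0 \<le> a" "0 \<le> a1" "0 \<le> a0" "0 \<le> b" "0 \<le> b1" "0 \<le> b0"
    and le: "\<And>t. t > 0 \<Longrightarrow> a * h t + a1 * h1 t + a0 \<le> b * h t + b1 * h1 t + b0"
  defines "V \<equiv> (\<lambda>h. Vfun h F1 F2 \<psi> (normalize g (legendre \<psi>)))"
    and "I1 \<equiv> Iint (\<lambda>x. F1 (real_of_ereal (\<psi> x))) \<psi>"
  shows "ennreal a * V h + ennreal a1 * V h1 + ennreal a0 * I1
       \<le> ennreal b * V h + ennreal b1 * V h1 + ennreal b0 * I1"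
proof -
  define R where "R = restrict_space lebesgue (Xset \<psi>)"
  define \<rho> where "\<rho> = orlicz_ratio F2 \<psi> (normalize g (legendre \<psi>))"
  define w where "w = (\<lambda>x. F1 (real_of_ereal (\<psi> x)))"
  have sp: "space R = Xset \<psi>" by (simp add: R_def space_restrict_space)
  have \<rho>: "\<rho> \<in> borel_measurable R" "\<And>x. x \<in> space R \<Longrightarrow> 0 < \<rho> x"
    using orlicz_ratio_measurable[OF cv cv' g F2(1)] orlicz_ratio_pos[OF cv g F2(2)] unfolding R_def[symmetric] \<rho>_def sp by auto
  have w[measurable]: "w \<in> borel_measurable R"
    unfolding w_def R_def by (rule measurable_compose[OF real_of_ereal_Xset_measurable[OF cv] F1(1)])
  have wpos: "0 < w x" for x using F1(2) by (simp add: w_def)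
  \<comment> \<open>\<open>h\<close> is continuous only on the positive reals, so the composition
    goes through the subspace in which \<open>\<rho>\<close> takes its values.\<close>
  have hm: "(\<lambda>x. h (\<rho> x)) \<in> borel_measurable R" if "admissible h" for h
  proof (rule measurable_compose[of \<rho> _ "restrict_space borel {0<..}"])
    show "\<rho> \<in> measurable R (restrict_space borel {0<..})"
      using \<rho> by (intro measurable_restrict_space2) auto
    show "h \<in> borel_measurable (restrict_space borel {0<..})"
      using that by (intro borel_measurable_continuous_on_restrict) (simp add: admissible_def)
  qed
  note [measurable] = hm[OF h(1)] hm[OF h(2)]
  have hpos: "0 < h (\<rho> x)" "0 < h1 (\<rho> x)" if "x \<in> space R" for x
    using h \<rho>(2)[OF that] by (auto simp: admissible_def)
  have V: "V k = (\<integral>\<^sup>+ x. ennreal (k (\<rho> x) * w x) \<partial>R)" for k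
    unfolding V_def \<rho>_def w_def R_def by (rule Vfun_eq_restrict[OF cv])
  have I: "I1 = (\<integral>\<^sup>+ x. ennreal (w x) \<partial>R)"
    unfolding I1_def w_def R_def by (rule Iint_eq_restrict[OF cv])
  have eq: "(\<integral>\<^sup>+ x. ennreal ((c * h (\<rho> x) + c1 * h1 (\<rho> x) + c0) * w x) \<partial>R)
      = ennreal c * V h + ennreal c1 * V h1 + ennreal c0 * I1"
    if c: "0 \<le> c" "0 \<le> c1" "0 \<le> c0" for c c1 c0
  proof -
    have "(\<integral>\<^sup>+ x. ennreal ((c * h (\<rho> x) + c1 * h1 (\<rho> x) + c0) * w x) \<partial>R)
       = (\<integral>\<^sup>+ x. (ennreal c * ennreal (h (\<rho> x) * w x) + ennreal c1 * ennreal (h1 (\<rho> x) * w x))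
            + ennreal c0 * ennreal (w x) \<partial>R)"
    proof (rule nn_integral_cong)
      fix x assume "x \<in> space R"
      then have "0 \<le> h (\<rho> x) * w x" "0 \<le> h1 (\<rho> x) * w x" "0 \<le> w x"
        using hpos[of x] wpos[of x] by auto
      then show "ennreal ((c * h (\<rho> x) + c1 * h1 (\<rho> x) + c0) * w x)
         = (ennreal c * ennreal (h (\<rho> x) * w x) + ennreal c1 * ennreal (h1 (\<rho> x) * w x)) + ennreal c0 * ennreal (w x)"
        using c by (simp add: ennreal_mult[symmetric] ennreal_plus[symmetric] distrib_right mult.assoc del: ennreal_plus)
    qed
    also have "\<dots> = ennreal c * V h + ennreal c1 * V h1 + ennreal c0 * I1"
      unfolding V I by (subst nn_integral_add, measurable)+ (simp add: nn_integral_cmult)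
    finally show ?thesis .
  qed
  have "(\<integral>\<^sup>+ x. ennreal ((a * h (\<rho> x) + a1 * h1 (\<rho> x) + a0) * w x) \<partial>R)
      \<le> (\<integral>\<^sup>+ x. ennreal ((b * h (\<rho> x) + b1 * h1 (\<rho> x) + b0) * w x) \<partial>R)"
    using \<rho>(2) le wpos by (intro nn_integral_mono ennreal_leI mult_right_mono) (auto simp: less_imp_le)
  then show ?thesis using eq nn by simp
qed

text \<open>For constant \<open>h\<close> the functional does not depend on \<open>g\<close>, so
  infimum and supremum over a nonempty class will agree. Both inequalities are instances of the
  affine comparison.\<close>

lemma Vfun_const:
  assumes "econvex \<psi>" "econvex (legendre \<psi>)" "g \<in> Fplus (legendre \<psi>)"
    "F1 \<in> borel_measurable borel" "\<forall>t. 0 < F1 t" "F2 \<in> borel_measurable borel" "\<forall>t. 0 < F2 t"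
    and h: "admissible h" "\<And>t. t > 0 \<Longrightarrow> h t = c"
  shows "Vfun h F1 F2 \<psi> (normalize g (legendre \<psi>)) = ennreal c * Iint (\<lambda>x. F1 (real_of_ereal (\<psi> x))) \<psi>"
proof (rule antisym)
  have c: "0 \<le> c" using h(1) h(2)[of 1] unfolding admissible_def by (metis less_imp_le zero_less_one)
  note V = Vfun_affine_mono[OF assms(1-7) h(1) h(1)]
  show "Vfun h F1 F2 \<psi> (normalize g (legendre \<psi>)) \<le> ennreal c * Iint (\<lambda>x. F1 (real_of_ereal (\<psi> x))) \<psi>"
    using V[of 1 0 0 0 0 c] c h(2) by simp
  show "ennreal c * Iint (\<lambda>x. F1 (real_of_ereal (\<psi> x))) \<psi> \<le> Vfun h F1 F2 \<psi> (normalize g (legendre \<psi>))"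
    using V[of 0 0 c 1 0 0] c h(2) by simp
qed

lemma Vfun_F2_legendre:
  fixes \<psi> :: "'a::euclidean_space \<Rightarrow> ereal"
  assumes cv: "econvex \<psi>"
    and F1: "F1 \<in> borel_measurable borel" "\<forall>t. 0 < F1 t" and F2: "\<forall>t. 0 < F2 t"
    and h: "admissible h"
  defines "g \<equiv> (\<lambda>y. F2 (real_of_ereal (legendre \<psi> y)))"
  defines "c \<equiv> (sqrt (2 * pi)) ^ DIM('a) / enn2real (Iint g (legendre \<psi>))"
  assumes g: "g \<in> Fplus (legendre \<psi>)"
  shows "0 < c" "Vfun h F1 F2 \<psi> (normalize g (legendre \<psi>)) = ennreal (h c) * Iint (\<lambda>x. F1 (real_of_ereal (\<psi> x))) \<psi>"
proof -
  define R where "R = restrict_space lebesgue (Xset \<psi>)"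
  have sp: "space R = Xset \<psi>" by (simp add: R_def space_restrict_space)
  show c: "0 < c" using g unfolding c_def Fplus_def by (auto simp: enn2real_positive_iff)
  have hc: "0 < h c" using h c by (simp add: admissible_def)
  have w[measurable]: "(\<lambda>x. F1 (real_of_ereal (\<psi> x))) \<in> borel_measurable R"
    unfolding R_def by (rule measurable_compose[OF real_of_ereal_Xset_measurable[OF cv] F1(1)])
  \<comment> \<open>By \<open>legendre_grad\<close> numerator and denominator evaluate
    \<open>F2\<close> at the same number and cancel, leaving the normalising factor.\<close>
  have ratio: "orlicz_ratio F2 \<psi> (normalize g (legendre \<psi>)) x = c" if "x \<in> space R" for x
    using legendre_grad[OF cv, of x] that F2[rule_format, of "inner x (grad \<psi> x) - real_of_ereal (\<psi> x)"]
    unfolding sp orlicz_ratio_def normalize_def c_def g_def by simp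
  have "Vfun h F1 F2 \<psi> (normalize g (legendre \<psi>)) = (\<integral>\<^sup>+ x. ennreal (h c) * ennreal (F1 (real_of_ereal (\<psi> x))) \<partial>R)"
    unfolding Vfun_eq_restrict[OF cv] R_def[symmetric]
    using hc F1 by (intro nn_integral_cong) (simp add: ratio ennreal_mult less_imp_le)
  also have "\<dots> = ennreal (h c) * Iint (\<lambda>x. F1 (real_of_ereal (\<psi> x))) \<psi>"
    unfolding Iint_eq_restrict[OF cv] R_def[symmetric] by (simp add: nn_integral_cmult)
  finally show "Vfun h F1 F2 \<psi> (normalize g (legendre \<psi>)) = ennreal (h c) * Iint (\<lambda>x. F1 (real_of_ereal (\<psi> x))) \<psi>" .
qed

section \<open>Comparison of Orlicz affine surface areas\<close>

text \<open>The error is scaled by the slope of a supporting line, which may be 0; hence the choice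
  \<open>e / (b + 1)\<close>.\<close>

lemma ennreal_le_mult_epsilon:
  fixes x y :: ennreal
  assumes "b \<ge> 0" "\<And>e::real. e > 0 \<Longrightarrow> x \<le> y + ennreal b * ennreal e"
  shows "x \<le> y"
proof (rule ennreal_le_epsilon)
  fix e :: real assume e: "0 < e"
  have "b * (e / (b + 1)) \<le> e" using assms(1) e by (simp add: field_simps)
  then have "ennreal b * ennreal (e / (b + 1)) \<le> ennreal e"
    using assms(1) e by (simp add: ennreal_mult[symmetric] ennreal_leI)
  then show "x \<le> y + ennreal e"
    using assms(2)[of "e / (b + 1)"] assms(1) e by (meson add_left_mono add_nonneg_pos divide_pos_pos order_trans zero_less_one)
qed

text \<open>The slope is the right derivative, as an infimum of difference quotients. Its sign is
  read off by testing the supporting line at a point of \<open>J\<close> on either side of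
  \<open>m\<close>.\<close>

lemma convex_on_open_tangent:
  fixes H :: "real \<Rightarrow> real"
  assumes "convex_on J H" "open J" "m \<in> J"
  shows "\<exists>b. (\<forall>s\<in>J. H m + b * (s - m) \<le> H s) \<and> (mono_on J H \<longrightarrow> 0 \<le> b) \<and> (antimono_on J H \<longrightarrow> b \<le> 0)"
proof -
  define b where "b = Inf ((\<lambda>t. (H m - H t) / (m - t)) ` ({m<..} \<inter> J))"
  have b: "H m + b * (s - m) \<le> H s" if "s \<in> J" for s
    unfolding b_def using convex_le_Inf_differential[OF assms(1) _ that, of m] assms by (simp add: interior_open)
  obtain e where e: "e > 0" "ball m e \<subseteq> J" using assms(2,3) by (meson openE)
  have mem: "m - e/2 \<in> J" "m + e/2 \<in> J" using e by (auto simp: subset_iff dist_real_def)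
  have 1: "0 \<le> b" if "mono_on J H"
  proof -
    have "H (m - e/2) \<le> H m" using monotone_onD[OF that mem(1) assms(3)] e by simp
    then have "0 \<le> b * e" using b[OF mem(1)] by simp
    then show ?thesis using e by (simp add: zero_le_mult_iff)
  qed
  have 2: "b \<le> 0" if "antimono_on J H"
  proof -
    have "H (m + e/2) \<le> H m" using monotone_onD[OF that assms(3) mem(2)] e by simp
    then have "b * e \<le> 0" using b[OF mem(2)] by simp
    then show ?thesis using e by (simp add: mult_le_0_iff)
  qed
  show ?thesis using b 1 2 by blast
qed

text \<open>Strict convexity and strict concavity contradict each other at the midpoint of 1 and 2,
  so only constants belong to both classes.\<close>

lemma PhiC_PsiC_const:
  assumes "PhiC h" "PsiC h"
  obtains c where "\<And>t. t > 0 \<Longrightarrow> h t = c"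
proof -
  have mid: "f (3/2) < (1/2) * f 1 + (1/2) * f 2" if "strict_convex_on {0<..} f" for f
    using that[unfolded strict_convex_on_def, rule_format, of 1 2 "1/2"] by simp
  have "\<not> (strict_convex_on {0<..} h \<and> strict_concave_on {0<..} h)"
    using mid[of h] mid[of "\<lambda>x. - h x"] unfolding strict_concave_on_def by auto
  then show ?thesis using assms that unfolding PhiC_def PsiC_def by blast
qed

lemma PhiC_admissible: "PhiC h \<Longrightarrow> admissible h" and PsiC_admissible: "PsiC h \<Longrightarrow> admissible h"
  by (auto simp: PhiC_def PsiC_def)

text \<open>The class \<open>C\<close> of test functions is kept abstract: \<open>Fplus\<close>
  yields \<open>as_orlicz\<close>, \<open>Lclass\<close> yields \<open>G_orlicz\<close>, and one
  argument serves both.\<close>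

locale orlicz_class =
  fixes \<psi> :: "'a::euclidean_space \<Rightarrow> ereal" and F1 F2 :: "real \<Rightarrow> real" and C :: "('a \<Rightarrow> real) set"
  assumes cv: "econvex \<psi>"
    and F1: "F1 \<in> borel_measurable borel" "\<forall>t. 0 < F1 t"
    and F2: "F2 \<in> borel_measurable borel" "\<forall>t. 0 < F2 t"
    and C: "C \<subseteq> Fplus (legendre \<psi>)"
    and I1_pos: "0 < Iint (\<lambda>x. F1 (real_of_ereal (\<psi> x))) \<psi>"
    and I1_fin: "Iint (\<lambda>x. F1 (real_of_ereal (\<psi> x))) \<psi> < \<infinity>"
begin

definition I1 :: ennreal where "I1 = Iint (\<lambda>x. F1 (real_of_ereal (\<psi> x))) \<psi>"

definition V :: "(real \<Rightarrow> real) \<Rightarrow> ('a \<Rightarrow> real) \<Rightarrow> ennreal" where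
  "V h g = Vfun h F1 F2 \<psi> (normalize g (legendre \<psi>))"

definition area :: "(real \<Rightarrow> real) \<Rightarrow> ennreal" where
  "area h = (if PhiC h then (INF g\<in>C. V h g) else (SUP g\<in>C. V h g))"

lemma I1: "I1 \<noteq> 0" "I1 \<noteq> top" "I1 < top"
  using I1_pos I1_fin by (auto simp: I1_def)

text \<open>A positive \<open>I1\<close> rules out an empty \<open>Xset \<psi>\<close>, which
  supplies a point where \<open>\<psi>\<close> is finite.\<close>

lemma cv': "econvex (legendre \<psi>)"
proof -
  have "Xset \<psi> \<noteq> {}"
  proof
    assume "Xset \<psi> = {}"
    then have "I1 = 0" by (simp add: I1_def Iint_def)
    with I1 show False by simp
  qed
  then obtain x where "\<psi> x < \<infinity>" by (auto simp: Xset_def)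
  then show ?thesis by (rule econvex_legendre[OF cv])
qed

lemmas V_affine_mono = Vfun_affine_mono[OF cv cv' _ F1 F2, folded V_def I1_def]

lemma area_Phi: "PhiC h \<Longrightarrow> area h = (INF g\<in>C. V h g)"
  by (simp add: area_def)

text \<open>\<open>area\<close> gives \<open>PhiC\<close> precedence, so the overlap of the two
  classes has to be settled: there \<open>V h\<close> is constant in \<open>g\<close>. Nonemptiness
  matters because an empty infimum is \<open>top\<close> and an empty supremum is 0.\<close>

lemma area_Psi:
  assumes "PsiC h" "C \<noteq> {}"
  shows "area h = (SUP g\<in>C. V h g)"
proof (cases "PhiC h")
  case True
  then obtain c where c: "\<And>t. t > 0 \<Longrightarrow> h t = c" using PhiC_PsiC_const assms(1) by blast
  have "V h g = ennreal c * I1" if "g \<in> C" for g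
    using Vfun_const[OF cv cv' _ F1 F2 PsiC_admissible[OF assms(1)] c] that C
    unfolding V_def I1_def by blast
  then have "(INF g\<in>C. V h g) = (INF g\<in>C. ennreal c * I1)" "(SUP g\<in>C. V h g) = (SUP g\<in>C. ennreal c * I1)"
    by (auto intro: INF_cong SUP_cong)
  then show ?thesis using True assms(2) by (simp add: area_def)
qed (simp add: area_def)

lemma area_approx:
  assumes "C \<noteq> {}" "area h \<noteq> top" "(e::real) > 0"
  obtains g where "g \<in> C" "V h g \<le> area h + ennreal e" "area h \<le> V h g + ennreal e"
proof (cases "PhiC h")
  case True
  then have "area h = (INF g\<in>C. V h g)" by (rule area_Phi)
  then obtain g where "g \<in> C" "V h g < area h + ennreal e"
    using INF_approx_ennreal[OF assms(3)] assms(2) by (metis infinity_ennreal_def)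
  moreover have "area h \<le> V h g + ennreal e"
    using \<open>g \<in> C\<close> unfolding \<open>area h = _\<close> by (meson INF_lower2 order_refl add_increasing2 zero_le)
  ultimately show ?thesis using that by (meson less_imp_le)
next
  case False
  then have A: "area h = (SUP g\<in>C. V h g)" by (simp add: area_def)
  then obtain g where "g \<in> C" "area h < V h g + ennreal e"
    using SUP_approx_ennreal[OF assms(3,1)] assms(2) by (metis infinity_ennreal_def)
  moreover have "V h g \<le> area h + ennreal e"
    using \<open>g \<in> C\<close> unfolding A by (meson SUP_upper order_refl add_increasing2 zero_le)
  ultimately show ?thesis using that by (meson less_imp_le)
qed

text \<open>Here \<open>m\<close> is the mean of \<open>h1\<close>, \<open>a\<close> stands for the
  value of \<open>H\<close> at \<open>m\<close>, and \<open>b\<close> for the absolute value of the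
  slope of a supporting line there.\<close>

context
  fixes h h1 :: "real \<Rightarrow> real" and a b m :: real
  assumes h: "admissible h" "admissible h1" and ne: "C \<noteq> {}"
    and nn: "0 \<le> a" "0 \<le> b" "0 \<le> m"
    and m: "area h1 = ennreal m * I1"
begin

lemma area_fin: "ennreal b * area h1 \<noteq> top" "area h1 \<noteq> top"
  unfolding m using I1 by (auto simp: ennreal_mult_eq_top_iff)

lemma mult_area_h1: "ennreal (b * m) * I1 = ennreal b * area h1"
  unfolding m using nn by (simp add: ennreal_mult mult.assoc)

text \<open>Subtraction in \<open>ennreal\<close> is avoided: the finite term
  \<open>ennreal b * area h1\<close> is carried on both sides and cancelled last.\<close>

lemma add_area_h1_cancel: "ennreal b * area h1 + x \<le> ennreal b * area h1 + y \<Longrightarrow> x \<le> y"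
  using area_fin(1) ennreal_add_left_cancel_le[of "ennreal b * area h1" x y] by (auto simp: infinity_ennreal_def)

text \<open>The slope is nonnegative, so \<open>V h\<close> is controlled from above by
  \<open>V h1\<close>. For infima a nearly optimal \<open>g\<close> for \<open>h1\<close> is
  inserted; for suprema \<open>V h1 g\<close> is bounded by \<open>area h1\<close> for every
  \<open>g\<close>.\<close>

lemma area_le_of_tangent:
  assumes le: "\<And>t. t > 0 \<Longrightarrow> h t + b * m \<le> a + b * h1 t"
    and hh: "(PhiC h \<and> PhiC h1) \<or> (PsiC h \<and> PsiC h1)"
  shows "area h \<le> ennreal a * I1"
proof -
  have V: "V h g + ennreal b * area h1 \<le> ennreal b * V h1 g + ennreal a * I1" if "g \<in> C" for g
    using V_affine_mono[OF _ h, of g 1 0 "b * m" 0 b a] that C nn le unfolding mult_area_h1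
    by (auto simp: algebra_simps)
  show ?thesis using hh
  proof
    assume P: "PhiC h \<and> PhiC h1"
    show ?thesis
    proof (rule ennreal_le_mult_epsilon[OF nn(2)])
      fix e :: real assume "e > 0"
      then obtain g where g: "g \<in> C" "V h1 g \<le> area h1 + ennreal e"
        using area_approx[OF ne area_fin(2)] by metis
      have "area h + ennreal b * area h1 \<le> V h g + ennreal b * area h1"
        using P g by (intro add_right_mono) (simp add: area_Phi INF_lower)
      also have "\<dots> \<le> ennreal b * V h1 g + ennreal a * I1" by (rule V[OF g(1)])
      also have "\<dots> \<le> ennreal b * (area h1 + ennreal e) + ennreal a * I1"
        by (intro add_right_mono mult_left_mono g) simp
      finally show "area h \<le> ennreal a * I1 + ennreal b * ennreal e"
        by - (rule add_area_h1_cancel, simp add: distrib_left ac_simps)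
    qed
  next
    assume P: "PsiC h \<and> PsiC h1"
    have "V h g \<le> ennreal a * I1" if g: "g \<in> C" for g
    proof -
      have "V h1 g \<le> area h1" using P g ne by (simp add: area_Psi SUP_upper)
      then have "ennreal b * V h1 g + ennreal a * I1 \<le> ennreal b * area h1 + ennreal a * I1"
        by (intro add_right_mono mult_left_mono) simp_all
      from order_trans[OF V[OF g] this] show ?thesis by - (rule add_area_h1_cancel, simp add: ac_simps)
    qed
    then show ?thesis using P ne by (simp add: area_Psi SUP_least)
  qed
qed

text \<open>The reverse bound exchanges the roles: infima are now handled for every
  \<open>g\<close>, and suprema through a nearly optimal \<open>g\<close> for
  \<open>h1\<close>.\<close>

lemma area_ge_of_tangent_increasing:
  assumes le: "\<And>t. t > 0 \<Longrightarrow> a + b * h1 t \<le> h t + b * m"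
    and hh: "(PhiC h \<and> PhiC h1) \<or> (PsiC h \<and> PsiC h1)"
  shows "ennreal a * I1 \<le> area h"
proof -
  have V: "ennreal b * V h1 g + ennreal a * I1 \<le> V h g + ennreal b * area h1" if "g \<in> C" for g
    using V_affine_mono[OF _ h, of g 0 b a 1 0 "b * m"] that C nn le unfolding mult_area_h1
    by (auto simp: algebra_simps)
  show ?thesis using hh
  proof
    assume P: "PhiC h \<and> PhiC h1"
    have "ennreal a * I1 \<le> V h g" if g: "g \<in> C" for g
    proof -
      have "area h1 \<le> V h1 g" using P g by (simp add: area_Phi INF_lower)
      then have "ennreal b * area h1 + ennreal a * I1 \<le> ennreal b * V h1 g + ennreal a * I1"
        by (intro add_right_mono mult_left_mono) simp_all
      also note V[OF g]
      finally show ?thesis by - (rule add_area_h1_cancel, simp add: ac_simps)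
    qed
    then show ?thesis using P by (simp add: area_Phi INF_greatest)
  next
    assume P: "PsiC h \<and> PsiC h1"
    show ?thesis
    proof (rule ennreal_le_mult_epsilon[OF nn(2)])
      fix e :: real assume "e > 0"
      then obtain g where g: "g \<in> C" "area h1 \<le> V h1 g + ennreal e"
        using area_approx[OF ne area_fin(2)] by metis
      have "ennreal b * area h1 + ennreal a * I1 \<le> ennreal b * (V h1 g + ennreal e) + ennreal a * I1"
        by (intro add_right_mono mult_left_mono g) simp
      also have "\<dots> = (ennreal b * V h1 g + ennreal a * I1) + ennreal b * ennreal e"
        by (simp add: distrib_left ac_simps)
      also have "\<dots> \<le> (V h g + ennreal b * area h1) + ennreal b * ennreal e"
        by (intro add_right_mono V g)
      also have "\<dots> \<le> (area h + ennreal b * area h1) + ennreal b * ennreal e"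
        using P g ne by (intro add_right_mono) (simp add: area_Psi SUP_upper)
      finally show "ennreal a * I1 \<le> area h + ennreal b * ennreal e"
        by - (rule add_area_h1_cancel, simp add: ac_simps)
    qed
  qed
qed

text \<open>With slope \<open>- b\<close> the term in \<open>h1\<close> moves to the side of
  \<open>h\<close>. An upper bound on \<open>V h1\<close> is then what is required, so an infimum
  for one function pairs with a supremum for the other.\<close>

lemma area_ge_of_tangent_decreasing:
  assumes le: "\<And>t. t > 0 \<Longrightarrow> a + b * m \<le> h t + b * h1 t"
    and hh: "(PhiC h \<and> PsiC h1) \<or> (PsiC h \<and> PhiC h1)"
  shows "ennreal a * I1 \<le> area h"
proof -
  have V: "ennreal a * I1 + ennreal b * area h1 \<le> V h g + ennreal b * V h1 g" if "g \<in> C" for g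
    using V_affine_mono[OF _ h, of g 0 0 "a + b * m" 1 b 0] that C nn le
    by (auto simp: ennreal_plus distrib_right mult_area_h1)
  show ?thesis using hh
  proof
    assume P: "PhiC h \<and> PsiC h1"
    have "ennreal a * I1 \<le> V h g" if g: "g \<in> C" for g
    proof -
      have "V h1 g \<le> area h1" using P g ne by (simp add: area_Psi SUP_upper)
      then have "V h g + ennreal b * V h1 g \<le> V h g + ennreal b * area h1"
        by (intro add_left_mono mult_left_mono) simp_all
      from order_trans[OF V[OF g] this] show ?thesis by - (rule add_area_h1_cancel, simp add: ac_simps)
    qed
    then show ?thesis using P by (simp add: area_Phi INF_greatest)
  next
    assume P: "PsiC h \<and> PhiC h1"
    show ?thesis
    proof (rule ennreal_le_mult_epsilon[OF nn(2)])
      fix e :: real assume "e > 0"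
      then obtain g where g: "g \<in> C" "V h1 g \<le> area h1 + ennreal e"
        using area_approx[OF ne area_fin(2)] by metis
      have "ennreal a * I1 + ennreal b * area h1 \<le> V h g + ennreal b * V h1 g" by (rule V[OF g(1)])
      also have "\<dots> \<le> area h + ennreal b * (area h1 + ennreal e)"
        using P g ne by (intro add_mono mult_left_mono) (simp_all add: area_Psi SUP_upper)
      finally show "ennreal a * I1 \<le> area h + ennreal b * ennreal e"
        by - (rule add_area_h1_cancel, simp add: distrib_left ac_simps)
    qed
  qed
qed

end

text \<open>\<open>mem\<close> says that the mean of \<open>h1\<close> is a value of
  \<open>h1\<close>, that is, a point of the domain of \<open>H\<close>; it is therefore finite and
  positive.\<close>

context
  fixes h h1 :: "real \<Rightarrow> real"
  assumes inj: "inj_on h1 {0<..}"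
    and mem: "area h1 / I1 \<in> ennreal ` (h1 ` {0<..})"
    and h1: "PhiC h1 \<or> PsiC h1" and h: "PhiC h \<or> PsiC h"
begin

abbreviation J where "J \<equiv> h1 ` {0<..}"
abbreviation H where "H \<equiv> \<lambda>s. h (the_inv_into {0<..} h1 s)"
abbreviation m where "m \<equiv> enn2real (area h1 / I1)"
abbreviation F2_legendre where "F2_legendre \<equiv> (\<lambda>y. F2 (real_of_ereal (legendre \<psi> y)))"

lemma admissible_h_h1: "admissible h" "admissible h1"
  using h h1 PhiC_admissible PsiC_admissible by blast+

lemma H_h1: "t > 0 \<Longrightarrow> H (h1 t) = h t"
  using the_inv_into_f_f[OF inj, of t] by simp

text \<open>An injective continuous image of an open interval is open, so supporting lines can be
  tested on both sides of \<open>m\<close>.\<close>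

lemma open_J: "open J"
  using injective_eq_1d_open_map_UNIV[of "{0<..}" h1] admissible_h_h1 inj
  by (auto simp: admissible_def is_interval_io)

lemma J_pos: "s \<in> J \<Longrightarrow> 0 < s"
  using admissible_h_h1 by (auto simp: admissible_def)

lemma H_pos: "s \<in> J \<Longrightarrow> 0 < H s"
  using admissible_h_h1 H_h1 by (auto simp: admissible_def)

lemma mean_h1: "m \<in> J" "area h1 / I1 = ennreal m" "area h1 = ennreal m * I1" "0 < m" "0 < H m"
proof -
  obtain s where s: "s \<in> J" "area h1 / I1 = ennreal s" using mem by blast
  then have "m = s" using J_pos[of s] by simp
  with s show 1: "m \<in> J" and 2: "area h1 / I1 = ennreal m" by auto
  have "area h1 = (area h1 / I1) * I1"
    using I1 mult_divide_eq_ennreal[of I1 "area h1"] ennreal_times_divide[of I1 "area h1" I1]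
    by (simp add: mult.commute)
  with 2 show "area h1 = ennreal m * I1" by simp
  show "0 < m" "0 < H m" using J_pos[OF 1] H_pos[OF 1] by auto
qed

text \<open>For an empty class the area would be \<open>top\<close> or 0, and its ratio to
  \<open>I1\<close> could not be a positive real.\<close>

lemma C_nonempty: "C \<noteq> {}"
proof
  assume "C = {}"
  then have "area h1 = top \<or> area h1 = 0" unfolding area_def by (simp add: bot_ennreal)
  then show False using mean_h1(2,4) I1 by (auto simp: ennreal_top_divide)
qed

lemma area_le_iff: "area h / I1 \<le> ennreal a \<longleftrightarrow> area h \<le> ennreal a * I1"
  and area_ge_iff: "ennreal a \<le> area h / I1 \<longleftrightarrow> ennreal a * I1 \<le> area h"
proof -
  have eq: "(area h / I1) * I1 = area h" "(ennreal a * I1) / I1 = ennreal a"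
    using I1 mult_divide_eq_ennreal[of I1] ennreal_times_divide[of I1 "area h" I1]
    by (metis mult.commute)+
  show "area h / I1 \<le> ennreal a \<longleftrightarrow> area h \<le> ennreal a * I1"
    "ennreal a \<le> area h / I1 \<longleftrightarrow> ennreal a * I1 \<le> area h"
    using eq by (metis divide_right_mono_ennreal mult_right_mono zero_le)+
qed

lemma V_F2_legendre:
  assumes "F2_legendre \<in> C"
  obtains c where "c > 0" "V h F2_legendre = ennreal (h c) * I1" "V h1 F2_legendre = ennreal (h1 c) * I1"
proof -
  have "F2_legendre \<in> Fplus (legendre \<psi>)" using assms C by blast
  note V = Vfun_F2_legendre[OF cv F1 F2(2) _ this, folded V_def I1_def]
  show ?thesis by (rule that[OF V(1)[OF admissible_h_h1(1)] V(2)[OF admissible_h_h1(1)] V(2)[OF admissible_h_h1(2)]])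
qed

lemma I1_mult_le_iff: "ennreal s * I1 \<le> ennreal t * I1 \<longleftrightarrow> ennreal s \<le> ennreal t"
  using I1 by (metis mult_divide_eq_ennreal divide_right_mono_ennreal mult_right_mono zero_le)

text \<open>The first two cases evaluate both functionals at \<open>F2_legendre\<close>, which
  places \<open>h1 c\<close> relative to \<open>m\<close>, and monotonicity of \<open>H\<close>
  carries this over to \<open>h c\<close>. The third uses a supporting line.\<close>

lemma area_upper:
  assumes "(PhiC h \<and> PsiC h1 \<and> mono_on J H \<and> F2_legendre \<in> C)
      \<or> (PhiC h \<and> PhiC h1 \<and> antimono_on J H \<and> F2_legendre \<in> C)
      \<or> (concave_on J H \<and> mono_on J H \<and> ((PhiC h \<and> PhiC h1) \<or> (PsiC h \<and> PsiC h1)))"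
  shows "area h / I1 \<le> ennreal (H m)"
  unfolding area_le_iff using assms
proof (elim disjE)
  assume *: "PhiC h \<and> PsiC h1 \<and> mono_on J H \<and> F2_legendre \<in> C"
  then obtain c where c: "c > 0" "V h F2_legendre = ennreal (h c) * I1" "V h1 F2_legendre = ennreal (h1 c) * I1"
    using V_F2_legendre by blast
  \<comment> \<open>\<open>area h1\<close> is a supremum here, so the test value lies below the
    mean; for \<open>PhiC h1\<close> the order is reversed, which is matched by decreasing
    \<open>H\<close>.\<close>
  have "V h1 F2_legendre \<le> area h1" using * C_nonempty by (simp add: area_Psi SUP_upper)
  then have "ennreal (h1 c) * I1 \<le> ennreal m * I1" by (simp only: c(3) flip: mean_h1(3))
  then have "h1 c \<le> m" unfolding I1_mult_le_iff using mean_h1(4) by (simp add: ennreal_le_iff)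
  then have "h c \<le> H m" using * mean_h1(1) c(1) H_h1[OF c(1)] monotone_onD[of J "(\<le>)" "(\<le>)" H "h1 c" m] by auto
  have "area h \<le> V h F2_legendre" using * by (simp add: area_Phi INF_lower)
  also have "\<dots> \<le> ennreal (H m) * I1" unfolding c(2) I1_mult_le_iff by (rule ennreal_leI) fact
  finally show "area h \<le> ennreal (H m) * I1" .
next
  assume *: "PhiC h \<and> PhiC h1 \<and> antimono_on J H \<and> F2_legendre \<in> C"
  then obtain c where c: "c > 0" "V h F2_legendre = ennreal (h c) * I1" "V h1 F2_legendre = ennreal (h1 c) * I1"
    using V_F2_legendre by blast
  have "area h1 \<le> V h1 F2_legendre" using * by (simp add: area_Phi INF_lower)
  then have "ennreal m * I1 \<le> ennreal (h1 c) * I1" by (simp only: c(3) flip: mean_h1(3))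
  then have "m \<le> h1 c" unfolding I1_mult_le_iff
    using J_pos[of "h1 c"] c(1) by (simp add: ennreal_le_iff)
  then have "h c \<le> H m" using * mean_h1(1) c(1) H_h1[OF c(1)]
      monotone_onD[of J "(\<le>)" "\<lambda>x y. y \<le> x" H m "h1 c"] by auto
  have "area h \<le> V h F2_legendre" using * by (simp add: area_Phi INF_lower)
  also have "\<dots> \<le> ennreal (H m) * I1" unfolding c(2) I1_mult_le_iff by (rule ennreal_leI) fact
  finally show "area h \<le> ennreal (H m) * I1" .
next
  assume *: "concave_on J H \<and> mono_on J H \<and> ((PhiC h \<and> PhiC h1) \<or> (PsiC h \<and> PsiC h1))"
  \<comment> \<open>The convex function is \<open>- H\<close>, so its supporting slope
    \<open>b\<close> is nonpositive, and \<open>H\<close> lies below a line of slope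
    \<open>- b \<ge> 0\<close>.\<close>
  have anti: "antimono_on J (\<lambda>s. - H s)" using * by (auto simp: monotone_on_def)
  obtain b where b: "\<And>s. s \<in> J \<Longrightarrow> - H m + b * (s - m) \<le> - H s" "b \<le> 0"
    using convex_on_open_tangent[OF _ open_J mean_h1(1), of "\<lambda>s. - H s"] * anti unfolding concave_on_def by auto
  show "area h \<le> ennreal (H m) * I1"
  proof (rule area_le_of_tangent[OF admissible_h_h1 C_nonempty, where b = "- b"])
    show "h t + - b * m \<le> H m + - b * h1 t" if "t > 0" for t
      using b(1)[of "h1 t"] H_h1[OF that] that by (simp add: algebra_simps)
  qed (use * b mean_h1 in auto)
qed

text \<open>In the first case \<open>area h\<close> is a supremum, so the test function bounds it
  from below. The convex cases differ only in the sign of the supporting slope.\<close>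

lemma area_lower:
  assumes "(PsiC h \<and> PhiC h1 \<and> mono_on J H \<and> F2_legendre \<in> C)
      \<or> (convex_on J H \<and> antimono_on J H \<and> ((PhiC h \<and> PsiC h1) \<or> (PsiC h \<and> PhiC h1)))
      \<or> (convex_on J H \<and> mono_on J H \<and> ((PhiC h \<and> PhiC h1) \<or> (PsiC h \<and> PsiC h1)))"
  shows "ennreal (H m) \<le> area h / I1"
  unfolding area_ge_iff using assms
proof (elim disjE)
  assume *: "PsiC h \<and> PhiC h1 \<and> mono_on J H \<and> F2_legendre \<in> C"
  then obtain c where c: "c > 0" "V h F2_legendre = ennreal (h c) * I1" "V h1 F2_legendre = ennreal (h1 c) * I1"
    using V_F2_legendre by blast
  have "area h1 \<le> V h1 F2_legendre" using * by (simp add: area_Phi INF_lower)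
  then have "ennreal m * I1 \<le> ennreal (h1 c) * I1" by (simp only: c(3) flip: mean_h1(3))
  then have "m \<le> h1 c" unfolding I1_mult_le_iff
    using J_pos[of "h1 c"] c(1) by (simp add: ennreal_le_iff)
  then have "H m \<le> h c" using * mean_h1(1) c(1) H_h1[OF c(1)]
      monotone_onD[of J "(\<le>)" "(\<le>)" H m "h1 c"] by auto
  then have "ennreal (H m) * I1 \<le> V h F2_legendre" unfolding c(2) I1_mult_le_iff by (rule ennreal_leI)
  also have "\<dots> \<le> area h" using * C_nonempty by (simp add: area_Psi SUP_upper)
  finally show "ennreal (H m) * I1 \<le> area h" .
next
  assume *: "convex_on J H \<and> antimono_on J H \<and> ((PhiC h \<and> PsiC h1) \<or> (PsiC h \<and> PhiC h1))"
  obtain b where b: "\<And>s. s \<in> J \<Longrightarrow> H m + b * (s - m) \<le> H s" "b \<le> 0"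
    using convex_on_open_tangent[OF _ open_J mean_h1(1), of H] * by auto
  show "ennreal (H m) * I1 \<le> area h"
  proof (rule area_ge_of_tangent_decreasing[OF admissible_h_h1 C_nonempty, where b = "- b"])
    show "H m + - b * m \<le> h t + - b * h1 t" if "t > 0" for t
      using b(1)[of "h1 t"] H_h1[OF that] that by (simp add: algebra_simps)
  qed (use * b mean_h1 in auto)
next
  assume *: "convex_on J H \<and> mono_on J H \<and> ((PhiC h \<and> PhiC h1) \<or> (PsiC h \<and> PsiC h1))"
  obtain b where b: "\<And>s. s \<in> J \<Longrightarrow> H m + b * (s - m) \<le> H s" "0 \<le> b"
    using convex_on_open_tangent[OF _ open_J mean_h1(1), of H] * by auto
  show "ennreal (H m) * I1 \<le> area h"
  proof (rule area_ge_of_tangent_increasing[OF admissible_h_h1 C_nonempty, where b = b])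
    show "H m + b * h1 t \<le> h t + b * m" if "t > 0" for t
      using b(1)[of "h1 t"] H_h1[OF that] that by (simp add: algebra_simps)
  qed (use * b mean_h1 in auto)
qed

end

end

text \<open>\<open>J\<close> is the domain of \<open>H\<close>. The ratio of the
  \<open>h1\<close>-area to \<open>I1\<close> is required to come from a point of \<open>J\<close>,
  so \<open>enn2real\<close> recovers that point and \<open>H\<close> is evaluated where it is
  meaningful.\<close>

theorem theorem2p4:
  fixes \<psi> :: "'a::euclidean_space \<Rightarrow> ereal"
    and F1 F2 h h1 :: "real \<Rightarrow> real"
  defines "J \<equiv> h1 ` {0<..}"
      and "H \<equiv> (\<lambda>s. h (the_inv_into {0<..} h1 s))"
      and "I1 \<equiv> Iint (\<lambda>x. F1 (real_of_ereal (\<psi> x))) \<psi>"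
  assumes F1meas: "F1 \<in> borel_measurable borel" and F1pos: "\<forall>t. 0 < F1 t"
      and F2meas: "F2 \<in> borel_measurable borel" and F2pos: "\<forall>t. 0 < F2 t"
      and psiC: "convC \<psi>"
      and I1pos: "0 < I1" and I1fin: "I1 < \<infinity>"
      and I2pos: "0 < Iint (\<lambda>y. F2 (real_of_ereal (legendre \<psi> y))) (legendre \<psi>)"
      and I2fin: "Iint (\<lambda>y. F2 (real_of_ereal (legendre \<psi> y))) (legendre \<psi>) < \<infinity>"
      and h1inj: "inj_on h1 {0<..}"
  shows
   "(((PhiC h \<and> PsiC h1 \<and> mono_on J H)
      \<or> (PhiC h \<and> PhiC h1 \<and> antimono_on J H)
      \<or> (concave_on J H \<and> mono_on J H \<and> ((PhiC h \<and> PhiC h1) \<or> (PsiC h \<and> PsiC h1))))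
     \<and> as_orlicz h1 F1 F2 \<psi> / I1 \<in> ennreal ` J
     \<longrightarrow> as_orlicz h F1 F2 \<psi> / I1 \<le> ennreal (H (enn2real (as_orlicz h1 F1 F2 \<psi> / I1))))
  \<and> (((PsiC h \<and> PhiC h1 \<and> mono_on J H)
      \<or> (convex_on J H \<and> antimono_on J H \<and> ((PhiC h \<and> PsiC h1) \<or> (PsiC h \<and> PhiC h1)))
      \<or> (convex_on J H \<and> mono_on J H \<and> ((PhiC h \<and> PhiC h1) \<or> (PsiC h \<and> PsiC h1))))
     \<and> as_orlicz h1 F1 F2 \<psi> / I1 \<in> ennreal ` J
     \<longrightarrow> ennreal (H (enn2real (as_orlicz h1 F1 F2 \<psi> / I1))) \<le> as_orlicz h F1 F2 \<psi> / I1)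
  \<and> ((((PhiC h \<and> PsiC h1 \<and> mono_on J H) \<and> (\<lambda>y. F2 (real_of_ereal (legendre \<psi> y))) \<in> Lclass (legendre \<psi>))
      \<or> ((PhiC h \<and> PhiC h1 \<and> antimono_on J H) \<and> (\<lambda>y. F2 (real_of_ereal (legendre \<psi> y))) \<in> Lclass (legendre \<psi>))
      \<or> (concave_on J H \<and> mono_on J H \<and> ((PhiC h \<and> PhiC h1) \<or> (PsiC h \<and> PsiC h1))))
     \<and> G_orlicz h1 F1 F2 \<psi> / I1 \<in> ennreal ` J
     \<longrightarrow> G_orlicz h F1 F2 \<psi> / I1 \<le> ennreal (H (enn2real (G_orlicz h1 F1 F2 \<psi> / I1))))
  \<and> ((((PsiC h \<and> PhiC h1 \<and> mono_on J H) \<and> (\<lambda>y. F2 (real_of_ereal (legendre \<psi> y))) \<in> Lclass (legendre \<psi>))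
      \<or> (convex_on J H \<and> antimono_on J H \<and> ((PhiC h \<and> PsiC h1) \<or> (PsiC h \<and> PhiC h1)))
      \<or> (convex_on J H \<and> mono_on J H \<and> ((PhiC h \<and> PhiC h1) \<or> (PsiC h \<and> PsiC h1))))
     \<and> G_orlicz h1 F1 F2 \<psi> / I1 \<in> ennreal ` J
     \<longrightarrow> ennreal (H (enn2real (G_orlicz h1 F1 F2 \<psi> / I1))) \<le> G_orlicz h F1 F2 \<psi> / I1)"
proof -
  have cv: "econvex \<psi>" by (rule convC_imp_econvex[OF psiC])
  have I: "0 < Iint (\<lambda>x. F1 (real_of_ereal (\<psi> x))) \<psi>" "Iint (\<lambda>x. F1 (real_of_ereal (\<psi> x))) \<psi> < \<infinity>"
    using I1pos I1fin by (simp_all add: I1_def)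
  interpret P: orlicz_class \<psi> F1 F2 "Fplus (legendre \<psi>)"
    by unfold_locales (use cv F1meas F1pos F2meas F2pos I in auto)
  interpret L: orlicz_class \<psi> F1 F2 "Lclass (legendre \<psi>)"
    by unfold_locales (use cv F1meas F1pos F2meas F2pos I in \<open>auto simp: Lclass_def\<close>)
  have PI: "P.I1 = I1" and LI: "L.I1 = I1" by (simp_all add: P.I1_def L.I1_def I1_def)
  have PA: "P.area k = as_orlicz k F1 F2 \<psi>" and LA: "L.area k = G_orlicz k F1 F2 \<psi>" for k
    by (simp_all add: P.area_def P.V_def as_orlicz_def L.area_def L.V_def G_orlicz_def)
  have H_apply: "h (the_inv_into {0<..} h1 s) = H s" for s by (simp add: H_def)
  \<comment> \<open>Finiteness and positivity of the second integral make the test function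
    available in \<open>Fplus\<close>; for \<open>Lclass\<close> its membership comes with the case
    hypotheses.\<close>
  have F2P: "(\<lambda>y. F2 (real_of_ereal (legendre \<psi> y))) \<in> Fplus (legendre \<psi>)"
    by (rule F2_legendre_Fplus[OF P.cv' F2meas F2pos I2pos I2fin])
  show ?thesis
  proof (intro conjI impI, goal_cases)
    case 1
    then show ?case
      using P.area_upper[OF h1inj, of h, unfolded PI PA, folded J_def H_def, unfolded H_apply] F2P by blast
  next
    case 2
    then show ?case
      using P.area_lower[OF h1inj, of h, unfolded PI PA, folded J_def H_def, unfolded H_apply] F2P by blast
  next
    case 3
    then show ?case
      using L.area_upper[OF h1inj, of h, unfolded LI LA, folded J_def H_def, unfolded H_apply] by blast
  next
    case 4
    then show ?case
      using L.area_lower[OF h1inj, of h, unfolded LI LA, folded J_def H_def, unfolded H_apply] by blast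
  qed
qed

end
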